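(* Let $A=[(A_\varepsilon)_\varepsilon]\in M(n,\widetilde{\mathbb C})$ be Hermitian. For each $\varepsilon$ let $\lambda_k^\varepsilon=\mu_{k,\varepsilon}+i\nu_{k,\varepsilon}$ ($1\le k\le n$; $\mu_{k,\varepsilon},\nu_{k,\varepsilon}\in\mathbb R$) be the eigenvalues of $A_\varepsilon$ (counted with multiplicity), ordered by the size of their real parts: $\mu_{1,\varepsilon}\ge\dots\ge\mu_{n,\varepsilon}$. Then the $\lambda_k:=[(\lambda_k^\varepsilon)_\varepsilon]$ are well-defined elements $\lambda_1\ge\dots\ge\lambda_n$ of $\widetilde{\mathbb R}$, independent of the representative $(A_\varepsilon)_\varepsilon$ of $A$. Any eigenvalue of $A$ is an interleaving of $\{\lambda_1,\dots,\lambda_n\}$. Moreover, there exists a unitary matrix $U\in M(n,\widetilde{\mathbb C})$ such that $U^*AU=\mathrm{diag}(\lambda_1,\dots,\lambda_n)$.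
   Context: For $\mathbb K=\mathbb R$ or $\mathbb C$, the ring of Colombeau generalized numbers is $\widetilde{\mathbb K}=\mathcal E_M/\mathcal N$, where $\mathcal E_M=\{(r_\varepsilon)_{\varepsilon\in(0,1]}\in\mathbb K^{(0,1]}:\exists N\in\mathbb N,\ |r_\varepsilon|=O(\varepsilon^{-N})\ (\varepsilon\to0)\}$ and $\mathcal N=\{(r_\varepsilon)_{\varepsilon\in(0,1]}\in\mathbb K^{(0,1]}:\forall m\in\mathbb N,\ |r_\varepsilon|=O(\varepsilon^{m})\ (\varepsilon\to0)\}$, with operations (including complex conjugation) defined componentwise on representatives; $[(r_\varepsilon)_\varepsilon]$ denotes the class of $(r_\varepsilon)_\varepsilon$, and $\widetilde{\mathbb R}\subseteq\widetilde{\mathbb C}$. For $r,s\in\widetilde{\mathbb R}$, $r\ge s$ means that there are representatives with $r_\varepsilon\ge s_\varepsilon$ for all $\varepsilon$. $M(n,\widetilde{\mathbb K})$ is the set of $n\times n$ matrices with entries in $\widetilde{\mathbb K}$. A representative of $A\in M(n,\widetilde{\mathbb K})$ is a net $(A_\varepsilon)_{\varepsilon\in(0,1]}$ of matrices in $M(n,\mathbb K)$ whose entries are representatives of the entries of $A$; one writes $A=[(A_\varepsilon)_\varepsilon]$. $A\in M(n,\widetilde{\mathbb C})$ is Hermitian if $A^*=A$ and $U$ is unitary if $U^*U=I$, where $*$ is the conjugate transpose. A vector $x\in\widetilde{\mathbb C}^n$ is free if $\mu x=0$ with $\mu\in\widetilde{\mathbb C}$ implies $\mu=0$. $\lambda\in\widetilde{\mathbb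 C}$ is an eigenvalue of $A\in M(n,\widetilde{\mathbb C})$ if there is a free $x\in\widetilde{\mathbb C}^n$ with $Ax=\lambda x$. For $S\subseteq(0,1]$, $e_S$ is the class of the characteristic function of $S$. $\lambda\in\widetilde{\mathbb C}$ is an interleaving of $\{\lambda_1,\dots,\lambda_n\}\subseteq\widetilde{\mathbb C}$ if there is a partition $\{S_1,\dots,S_n\}$ of $(0,1]$ (empty parts allowed) with $\lambda=\lambda_1e_{S_1}+\dots+\lambda_ne_{S_n}$. *)

theory Defs
  imports "Jordan_Normal_Form.Char_Poly" "HOL-Library.Landau_Symbols"
begin

section \<open>Colombeau generalized numbers\<close>

text \<open>A net indexed by \<open>(0,1]\<close> is represented by a function on \<open>real\<close> whose values outside
  \<open>{0<..1}\<close> are irrelevant: \<open>moderate\<close> and \<open>negligible\<close> only see the germ at \<open>0+\<close>, and every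
  pointwise condition below is restricted to \<open>{0<..1}\<close>.\<close>

definition moderate :: "(real \<Rightarrow> 'a::real_normed_field) \<Rightarrow> bool" where
  "moderate r \<longleftrightarrow> (\<exists>N::nat. (\<lambda>\<epsilon>. norm (r \<epsilon>)) \<in> O[at_right 0](\<lambda>\<epsilon>. 1 / \<epsilon> ^ N))"

definition negligible :: "(real \<Rightarrow> 'a::real_normed_field) \<Rightarrow> bool" where
  "negligible r \<longleftrightarrow> (\<forall>m::nat. (\<lambda>\<epsilon>. norm (r \<epsilon>)) \<in> O[at_right 0](\<lambda>\<epsilon>. \<epsilon> ^ m))"

lemma pos_at_right_0: "eventually (\<lambda>\<epsilon>::real. \<epsilon> > 0) (at_right 0)"
  by (simp add: eventually_at_right_less)

lemma small_at_right_0: "eventually (\<lambda>\<epsilon>::real. 0 < \<epsilon> \<and> \<epsilon> < 1) (at_right 0)"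
  by (rule eventually_conj) (auto intro: eventually_at_right_less eventually_at_rightI[of 0 1])

lemma inverse_power_bigo:
  assumes "N \<le> M"
  shows "(\<lambda>\<epsilon>::real. 1 / \<epsilon> ^ N) \<in> O[at_right 0](\<lambda>\<epsilon>. 1 / \<epsilon> ^ M)"
proof (rule landau_o.big_mono, rule eventually_mono[OF small_at_right_0])
  fix \<epsilon> :: real assume "0 < \<epsilon> \<and> \<epsilon> < 1"
  then have "\<epsilon> ^ M \<le> \<epsilon> ^ N" "\<epsilon> ^ M > 0" using assms by (auto intro: power_decreasing)
  then show "norm (1 / \<epsilon> ^ N) \<le> norm (1 / \<epsilon> ^ M)"
    using \<open>0 < \<epsilon> \<and> \<epsilon> < 1\<close> by (simp add: frac_le)
qed

lemma norm_bigo_bound: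
  assumes "\<And>\<epsilon>. norm (f \<epsilon>) \<le> g \<epsilon>" "g \<in> O[F](h)"
  shows "(\<lambda>\<epsilon>::real. norm (f \<epsilon>)) \<in> O[F](h)"
proof (rule landau_o.big_trans[OF _ assms(2)])
  show "(\<lambda>\<epsilon>. norm (f \<epsilon>)) \<in> O[F](g)"
    by (rule landau_o.big_mono) (auto intro!: always_eventually order_trans[OF assms(1)])
qed

lemma negligible_moderate: "negligible r \<Longrightarrow> moderate r"
  unfolding negligible_def moderate_def
  by (rule exI[of _ 0]) (auto dest: spec[of _ 0])

lemma moderate_add:
  assumes "moderate r" "moderate s"
  shows "moderate (\<lambda>\<epsilon>. r \<epsilon> + s \<epsilon>)"
proof -
  from assms obtain N M :: nat where
    N: "(\<lambda>\<epsilon>. norm (r \<epsilon>)) \<in> O[at_right 0](\<lambda>\<epsilon>. 1 / \<epsilon> ^ N)" and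
    M: "(\<lambda>\<epsilon>. norm (s \<epsilon>)) \<in> O[at_right 0](\<lambda>\<epsilon>. 1 / \<epsilon> ^ M)"
    unfolding moderate_def by blast
  have "(\<lambda>\<epsilon>. norm (r \<epsilon>) + norm (s \<epsilon>)) \<in> O[at_right 0](\<lambda>\<epsilon>. 1 / \<epsilon> ^ (max N M))"
    by (intro sum_in_bigo landau_o.big_trans[OF N] landau_o.big_trans[OF M] inverse_power_bigo)
      auto
  from norm_bigo_bound[OF norm_triangle_ineq this] show ?thesis
    unfolding moderate_def by blast
qed

lemma moderate_mult:
  assumes "moderate r" "moderate s"
  shows "moderate (\<lambda>\<epsilon>. r \<epsilon> * s \<epsilon>)"
proof -
  from assms obtain N M :: nat where
    N: "(\<lambda>\<epsilon>. norm (r \<epsilon>)) \<in> O[at_right 0](\<lambda>\<epsilon>. 1 / \<epsilon> ^ N)" and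
    M: "(\<lambda>\<epsilon>. norm (s \<epsilon>)) \<in> O[at_right 0](\<lambda>\<epsilon>. 1 / \<epsilon> ^ M)"
    unfolding moderate_def by blast
  show ?thesis unfolding moderate_def
    using landau_o.big.mult[OF N M] by (auto simp: norm_mult power_add intro!: exI[of _ "N + M"])
qed

lemma moderate_cong_norm: "moderate r \<Longrightarrow> (\<And>\<epsilon>. norm (s \<epsilon>) = norm (r \<epsilon>)) \<Longrightarrow> moderate s"
  unfolding moderate_def by simp

lemma negligible_cong_norm: "negligible r \<Longrightarrow> (\<And>\<epsilon>. norm (s \<epsilon>) = norm (r \<epsilon>)) \<Longrightarrow> negligible s"
  unfolding negligible_def by simp

lemma moderate_uminus: "moderate r \<Longrightarrow> moderate (\<lambda>\<epsilon>. - r \<epsilon>)"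
  by (erule moderate_cong_norm) simp

lemma negligible_minus_commute:
  "negligible (\<lambda>\<epsilon>. r \<epsilon> - s \<epsilon>) \<Longrightarrow> negligible (\<lambda>\<epsilon>. s \<epsilon> - r \<epsilon>)"
  by (erule negligible_cong_norm) (rule norm_minus_commute)

lemma moderate_bounded: "(\<And>\<epsilon>. norm (r \<epsilon>) \<le> C) \<Longrightarrow> moderate r"
  unfolding moderate_def
  by (rule exI[of _ 0]) (auto intro!: bigoI[of _ C] always_eventually)

lemma moderate_one: "moderate (\<lambda>_. 1)"
  by (rule moderate_bounded[of _ 1]) simp

lemma negligible_add:
  assumes "negligible r" "negligible s"
  shows "negligible (\<lambda>\<epsilon>. r \<epsilon> + s \<epsilon>)"
  unfolding negligible_def
proof
  fix m :: nat
  have "(\<lambda>\<epsilon>. norm (r \<epsilon>) + norm (s \<epsilon>)) \<in> O[at_right 0](\<lambda>\<epsilon>. \<epsilon> ^ m)"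
    using assms unfolding negligible_def by (intro sum_in_bigo) auto
  then show "(\<lambda>\<epsilon>. norm (r \<epsilon> + s \<epsilon>)) \<in> O[at_right 0](\<lambda>\<epsilon>. \<epsilon> ^ m)"
    by (rule norm_bigo_bound[OF norm_triangle_ineq])
qed

lemma negligible_mult:
  assumes "moderate r" "negligible s"
  shows "negligible (\<lambda>\<epsilon>. r \<epsilon> * s \<epsilon>)"
  unfolding negligible_def
proof
  fix m :: nat
  from assms(1) obtain N :: nat where
    N: "(\<lambda>\<epsilon>. norm (r \<epsilon>)) \<in> O[at_right 0](\<lambda>\<epsilon>. 1 / \<epsilon> ^ N)"
    unfolding moderate_def by blast
  have "(\<lambda>\<epsilon>. norm (s \<epsilon>)) \<in> O[at_right 0](\<lambda>\<epsilon>. \<epsilon> ^ (N + m))"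
    using assms(2) unfolding negligible_def by blast
  from landau_o.big.mult[OF N this]
  have "(\<lambda>\<epsilon>. norm (r \<epsilon> * s \<epsilon>)) \<in> O[at_right 0](\<lambda>\<epsilon>. 1 / \<epsilon> ^ N * \<epsilon> ^ (N + m))"
    by (simp add: norm_mult)
  also have "O[at_right 0](\<lambda>\<epsilon>::real. 1 / \<epsilon> ^ N * \<epsilon> ^ (N + m)) = O[at_right 0](\<lambda>\<epsilon>. \<epsilon> ^ m)"
    by (rule landau_o.big.cong, rule eventually_mono[OF pos_at_right_0]) (simp add: power_add)
  finally show "(\<lambda>\<epsilon>. norm (r \<epsilon> * s \<epsilon>)) \<in> O[at_right 0](\<lambda>\<epsilon>. \<epsilon> ^ m)" .
qed

lemma negligible_zero [simp]: "negligible (\<lambda>_. 0)"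
  unfolding negligible_def by simp

lemma not_negligible_one: "\<not> negligible (\<lambda>_. 1 :: 'a::real_normed_field)"
proof
  assume "negligible (\<lambda>_. 1 :: 'a)"
  then have "(\<lambda>_. 1 :: real) \<in> O[at_right 0](\<lambda>\<epsilon>. \<epsilon> ^ 1)"
    unfolding negligible_def by (metis norm_one)
  then obtain c where c: "c > 0" "eventually (\<lambda>\<epsilon>::real. 1 \<le> c * \<bar>\<epsilon>\<bar>) (at_right 0)"
    by (auto elim!: landau_o.bigE)
  have "eventually (\<lambda>\<epsilon>::real. 0 < \<epsilon> \<and> \<epsilon> < 1 / c) (at_right 0)"
    using c(1) by (intro eventually_conj eventually_at_right_less eventually_at_rightI[of 0 "1/c"]) auto
  with c(2) have "eventually (\<lambda>\<epsilon>::real. False) (at_right 0)"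
    by eventually_elim (use c(1) in \<open>auto simp: field_simps\<close>)
  then show False by simp
qed

definition gen_rel :: "(real \<Rightarrow> 'a::real_normed_field) \<Rightarrow> (real \<Rightarrow> 'a) \<Rightarrow> bool" where
  "gen_rel r s \<longleftrightarrow> moderate r \<and> moderate s \<and> negligible (\<lambda>\<epsilon>. r \<epsilon> - s \<epsilon>)"

lemma gen_rel_part_equivp: "part_equivp (gen_rel :: (real \<Rightarrow> 'a::real_normed_field) \<Rightarrow> _)"
proof (rule part_equivpI)
  show "\<exists>x. gen_rel x (x :: real \<Rightarrow> 'a)"
    by (rule exI[of _ "\<lambda>_. 0"]) (simp add: gen_rel_def negligible_moderate)
  show "symp (gen_rel :: (real \<Rightarrow> 'a) \<Rightarrow> _)"
    by (rule sympI) (simp add: gen_rel_def negligible_minus_commute)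
  show "transp (gen_rel :: (real \<Rightarrow> 'a) \<Rightarrow> _)"
  proof (rule transpI)
    fix r s t :: "real \<Rightarrow> 'a"
    assume "gen_rel r s" "gen_rel s t"
    then show "gen_rel r t"
      using negligible_add[of "\<lambda>\<epsilon>. r \<epsilon> - s \<epsilon>" "\<lambda>\<epsilon>. s \<epsilon> - t \<epsilon>"] by (simp add: gen_rel_def)
  qed
qed

quotient_type (overloaded) 'a gen = "real \<Rightarrow> 'a::real_normed_field" / partial: gen_rel
  by (rule gen_rel_part_equivp)

instantiation gen :: (real_normed_field) comm_ring_1
begin

lift_definition zero_gen :: "'a gen" is "\<lambda>_. 0"
  by (simp add: gen_rel_def negligible_moderate)

lift_definition one_gen :: "'a gen" is "\<lambda>_. 1"
  by (simp add: gen_rel_def moderate_one)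

lift_definition plus_gen :: "'a gen \<Rightarrow> 'a gen \<Rightarrow> 'a gen" is "\<lambda>r s \<epsilon>. r \<epsilon> + s \<epsilon>"
  by (simp add: gen_rel_def moderate_add add_diff_add negligible_add)

lift_definition uminus_gen :: "'a gen \<Rightarrow> 'a gen" is "\<lambda>r \<epsilon>. - r \<epsilon>"
  by (simp add: gen_rel_def moderate_uminus negligible_minus_commute)

lift_definition minus_gen :: "'a gen \<Rightarrow> 'a gen \<Rightarrow> 'a gen" is "\<lambda>r s \<epsilon>. r \<epsilon> - s \<epsilon>"
proof -
  fix r r' s s' :: "real \<Rightarrow> 'a"
  assume "gen_rel r r'" "gen_rel s s'"
  then have m: "moderate r" "moderate r'" "moderate s" "moderate s'"
    and n: "negligible (\<lambda>\<epsilon>. r \<epsilon> - r' \<epsilon>)" "negligible (\<lambda>\<epsilon>. - (s \<epsilon> - s' \<epsilon>))"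
    by (simp_all add: gen_rel_def negligible_minus_commute)
  from m have m': "moderate (\<lambda>\<epsilon>. - s \<epsilon>)" "moderate (\<lambda>\<epsilon>. - s' \<epsilon>)"
    by (simp_all add: moderate_uminus)
  show "gen_rel (\<lambda>\<epsilon>. r \<epsilon> - s \<epsilon>) (\<lambda>\<epsilon>. r' \<epsilon> - s' \<epsilon>)"
    using moderate_add[OF m(1) m'(1)] moderate_add[OF m(2) m'(2)] negligible_add[OF n]
    by (simp add: gen_rel_def algebra_simps)
qed

lift_definition times_gen :: "'a gen \<Rightarrow> 'a gen \<Rightarrow> 'a gen" is "\<lambda>r s \<epsilon>. r \<epsilon> * s \<epsilon>"
proof -
  fix r r' s s' :: "real \<Rightarrow> 'a"
  assume "gen_rel r r'" "gen_rel s s'"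
  then have m: "moderate r" "moderate r'" "moderate s" "moderate s'"
    and n: "negligible (\<lambda>\<epsilon>. r \<epsilon> - r' \<epsilon>)" "negligible (\<lambda>\<epsilon>. s \<epsilon> - s' \<epsilon>)"
    by (auto simp: gen_rel_def)
  have "negligible (\<lambda>\<epsilon>. s \<epsilon> * (r \<epsilon> - r' \<epsilon>) + r' \<epsilon> * (s \<epsilon> - s' \<epsilon>))"
    using m n by (intro negligible_add negligible_mult)
  then show "gen_rel (\<lambda>\<epsilon>. r \<epsilon> * s \<epsilon>) (\<lambda>\<epsilon>. r' \<epsilon> * s' \<epsilon>)"
    using m by (simp add: gen_rel_def moderate_mult algebra_simps)
qed

instance
proof
  fix a b c :: "'a gen"
  note [simp] = gen_rel_def moderate_add moderate_mult moderate_uminus moderate_one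
    negligible_moderate
  show "a * b * c = a * (b * c)" by transfer (simp add: mult.assoc)
  show "a * b = b * a" by transfer (simp add: mult.commute)
  show "1 * a = a" by transfer simp
  show "a + b + c = a + (b + c)" by transfer (simp add: add.assoc)
  show "a + b = b + a" by transfer (simp add: add.commute)
  show "0 + a = a" by transfer simp
  show "- a + a = 0" by transfer simp
  show "a - b = a + - b"
  proof transfer
    fix r s :: "real \<Rightarrow> 'a"
    assume "gen_rel r r" "gen_rel s s"
    then show "gen_rel (\<lambda>\<epsilon>. r \<epsilon> - s \<epsilon>) (\<lambda>\<epsilon>. r \<epsilon> + - s \<epsilon>)"
      using moderate_add[of r "\<lambda>\<epsilon>. - s \<epsilon>"] by simp
  qed
  show "(a + b) * c = a * c + b * c" by transfer (simp add: distrib_right)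
  show "(0 :: 'a gen) \<noteq> 1"
  proof (transfer, rule notI)
    assume "gen_rel (\<lambda>_. 0 :: 'a) (\<lambda>_. 1)"
    then have "negligible (\<lambda>_. 0 - 1 :: 'a)" by (simp only: gen_rel_def)
    then have "negligible (\<lambda>_. 1 :: 'a)" by (rule negligible_cong_norm) simp
    with not_negligible_one show False by blast
  qed
qed

end

text \<open>\<open>represents r x\<close> means \<open>x = [(r\<^sub>\<epsilon>)\<^sub>\<epsilon>]\<close>; moderateness of \<open>r\<close> has to be demanded explicitly
  because \<open>abs_gen\<close> is unspecified elsewhere.\<close>

definition represents :: "(real \<Rightarrow> 'a::real_normed_field) \<Rightarrow> 'a gen \<Rightarrow> bool" where
  "represents r x \<longleftrightarrow> moderate r \<and> abs_gen r = x"

lift_definition gen_cnj :: "complex gen \<Rightarrow> complex gen" is "\<lambda>r \<epsilon>. cnj (r \<epsilon>)"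
proof -
  fix r s :: "real \<Rightarrow> complex"
  assume "gen_rel r s"
  then show "gen_rel (\<lambda>\<epsilon>. cnj (r \<epsilon>)) (\<lambda>\<epsilon>. cnj (s \<epsilon>))"
    by (simp add: gen_rel_def moderate_def negligible_def flip: complex_cnj_diff)
qed

lift_definition gen_of_real :: "real gen \<Rightarrow> complex gen" is "\<lambda>r \<epsilon>. complex_of_real (r \<epsilon>)"
proof -
  fix r s :: "real \<Rightarrow> real"
  assume "gen_rel r s"
  then have "moderate (\<lambda>\<epsilon>. complex_of_real (r \<epsilon>))" "moderate (\<lambda>\<epsilon>. complex_of_real (s \<epsilon>))"
    "negligible (\<lambda>\<epsilon>. complex_of_real (r \<epsilon> - s \<epsilon>))"
    by (auto simp: gen_rel_def moderate_def negligible_def simp del: of_real_diff)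
  then show "gen_rel (\<lambda>\<epsilon>. complex_of_real (r \<epsilon>)) (\<lambda>\<epsilon>. complex_of_real (s \<epsilon>))"
    by (simp add: gen_rel_def)
qed

lemma gen_of_real_inject [simp]: "gen_of_real x = gen_of_real y \<longleftrightarrow> x = y"
proof (transfer)
  fix r s :: "real \<Rightarrow> real"
  have *: "(\<lambda>\<epsilon>. norm (complex_of_real (r \<epsilon>) - complex_of_real (s \<epsilon>))) = (\<lambda>\<epsilon>. norm (r \<epsilon> - s \<epsilon>))"
    by (simp flip: of_real_diff)
  assume "gen_rel r r" "gen_rel s s"
  then show "gen_rel (\<lambda>\<epsilon>. complex_of_real (r \<epsilon>)) (\<lambda>\<epsilon>. complex_of_real (s \<epsilon>)) = gen_rel r s"
    unfolding gen_rel_def moderate_def negligible_def * by simp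
qed

definition gen_le :: "real gen \<Rightarrow> real gen \<Rightarrow> bool" (infix "\<le>\<^sub>g" 50) where
  "x \<le>\<^sub>g y \<longleftrightarrow> (\<exists>r s. represents r x \<and> represents s y \<and> (\<forall>\<epsilon>\<in>{0<..1}. r \<epsilon> \<le> s \<epsilon>))"

lift_definition gen_char :: "real set \<Rightarrow> complex gen" is "\<lambda>S \<epsilon>. if \<epsilon> \<in> S then 1 else 0"
  by (auto simp: gen_rel_def intro: moderate_bounded[of _ 1])

definition interleaving :: "nat \<Rightarrow> (nat \<Rightarrow> complex gen) \<Rightarrow> complex gen \<Rightarrow> bool" where
  "interleaving n l x \<longleftrightarrow>
    (\<exists>S :: nat \<Rightarrow> real set. disjoint_family_on S {..<n} \<and> (\<Union>k<n. S k) = {0<..1} \<and>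
      x = (\<Sum>k<n. l k * gen_char (S k)))"

section \<open>Matrices over generalized numbers\<close>

definition mat_represents :: "nat \<Rightarrow> (real \<Rightarrow> complex mat) \<Rightarrow> complex gen mat \<Rightarrow> bool" where
  "mat_represents n Ae A \<longleftrightarrow>
    (\<forall>\<epsilon>\<in>{0<..1}. Ae \<epsilon> \<in> carrier_mat n n) \<and>
    (\<forall>i<n. \<forall>j<n. represents (\<lambda>\<epsilon>. Ae \<epsilon> $$ (i, j)) (A $$ (i, j)))"

definition gen_adjoint :: "complex gen mat \<Rightarrow> complex gen mat" where
  "gen_adjoint A = transpose_mat (map_mat gen_cnj A)"

definition gen_hermitian :: "complex gen mat \<Rightarrow> bool" where
  "gen_hermitian A \<longleftrightarrow> gen_adjoint A = A"

definition gen_unitary :: "complex gen mat \<Rightarrow> bool" where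
  "gen_unitary U \<longleftrightarrow> gen_adjoint U * U = 1\<^sub>m (dim_col U)"

definition gen_free :: "complex gen vec \<Rightarrow> bool" where
  "gen_free x \<longleftrightarrow> (\<forall>\<mu>. \<mu> \<cdot>\<^sub>v x = 0\<^sub>v (dim_vec x) \<longrightarrow> \<mu> = 0)"

text \<open>Unlike the library's \<open>eigenvalue\<close>, this asks for a free rather than a nonzero eigenvector.\<close>

definition gen_eigenvalue :: "complex gen mat \<Rightarrow> complex gen \<Rightarrow> bool" where
  "gen_eigenvalue A l \<longleftrightarrow>
    (\<exists>x \<in> carrier_vec (dim_row A). gen_free x \<and> A *\<^sub>v x = l \<cdot>\<^sub>v x)"

text \<open>\<open>l 0, \<dots>, l (n - 1)\<close> enumerates the eigenvalues of \<open>M\<close>, with algebraic multiplicity, by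
  decreasing real part. The order among eigenvalues with equal real part is left open.\<close>

definition ordered_eigenvalues :: "nat \<Rightarrow> complex mat \<Rightarrow> (nat \<Rightarrow> complex) \<Rightarrow> bool" where
  "ordered_eigenvalues n M l \<longleftrightarrow>
    mset (map l [0..<n]) = proots (char_poly M) \<and>
    (\<forall>i j. i \<le> j \<and> j < n \<longrightarrow> Re (l j) \<le> Re (l i))"

lemma ordered_eigenvalues_exist:
  assumes "M \<in> carrier_mat n n"
  shows "\<exists>l. ordered_eigenvalues n M l"
proof -
  obtain ys where ys: "mset ys = proots (char_poly M)" using ex_mset by blast
  define xs where "xs = sort_key (\<lambda>z. - Re z) ys"
  have "length xs = size (proots (char_poly M))" by (simp add: xs_def flip: ys)
  also have "\<dots> = n" using degree_monic_char_poly[OF assms] by (simp add: size_proots_complex)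
  finally have len: "length xs = n" .
  have "sorted (map (\<lambda>z. - Re z) xs)" by (simp add: xs_def)
  then have "Re (xs ! j) \<le> Re (xs ! i)" if "i \<le> j" "j < n" for i j
    using that len sorted_nth_mono[of "map (\<lambda>z. - Re z) xs" i j] by simp
  moreover have "mset (map ((!) xs) [0..<n]) = proots (char_poly M)"
  proof -
    have "map ((!) xs) [0..<n] = xs" using map_nth[of xs] by (simp only: len)
    then show ?thesis by (simp only: xs_def mset_sort ys)
  qed
  ultimately show ?thesis unfolding ordered_eigenvalues_def by blast
qed

lemma mat_represents_exists:
  assumes "A \<in> carrier_mat n n"
  shows "\<exists>Ae. mat_represents n Ae A"
proof (intro exI)
  have "represents (rep_gen x) x" for x :: "complex gen"
    using Quotient_rep_reflp[OF Quotient_gen] Quotient_abs_rep[OF Quotient_gen]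
    by (auto simp: represents_def gen_rel_def)
  then show "mat_represents n (\<lambda>\<epsilon>. mat n n (\<lambda>ij. rep_gen (A $$ ij) \<epsilon>)) A"
    by (auto simp: mat_represents_def)
qed

end

(* A unitary Schur decomposition of each A_eps, with the prescribed eigenvalues on the diagonal, gives
   unitary U_eps, whose entries are bounded by 1, hence a unitary U over the generalized numbers such that
   U* A U is upper triangular. Being also Hermitian, U* A U is diagonal and real, although the A_eps themselves
   need not be Hermitian.

   If U and V diagonalize A with sorted diagonals l and m, then Q = U* V satisfies
   (l_i - m_j) Q_ij = 0. As |det Q_eps| = 1, the Leibniz formula yields a permutation p (depending on
   eps) with |Q_{i,p(i)}| >= 1/n! for all i, so l_i and m_{p(i)} are negligibly close; sorting does not
   increase the distance.

   For an eigenvector x, put y = U* x, so that (lambda - l_k) y_k = 0. With S_k the set of those eps at which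
   y_k is the entry of largest modulus, lambda minus the interleaving of the l_k along S_k annihilates y,
   which is free. *)
theory Submission
  imports Defs "Jordan_Normal_Form.Schur_Decomposition"
begin

section \<open>Unitary Schur decomposition\<close>

definition adj :: "complex mat \<Rightarrow> complex mat" where
  "adj M = transpose_mat (map_mat cnj M)"

lemma adj_dim [simp]: "dim_row (adj M) = dim_col M" "dim_col (adj M) = dim_row M"
  by (simp_all add: adj_def)

lemma adj_carrier [simp]: "M \<in> carrier_mat n m \<Longrightarrow> adj M \<in> carrier_mat m n"
  by (simp add: adj_def)

lemma adj_index [simp]: "i < dim_col M \<Longrightarrow> j < dim_row M \<Longrightarrow> adj M $$ (i, j) = cnj (M $$ (j, i))"
  by (simp add: adj_def)

lemma adj_adj [simp]: "adj (adj M) = M"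
  by (intro eq_matI) auto

lemma adj_mult:
  assumes "M \<in> carrier_mat n m" "N \<in> carrier_mat m k"
  shows "adj (M * N) = adj N * adj M"
proof -
  interpret cnj: comm_ring_hom cnj by unfold_locales auto
  show ?thesis
    using assms by (simp add: adj_def cnj.mat_hom_mult[OF assms] transpose_mult[of _ n m _ k])
qed

text \<open>A basis completion of \<open>v\<close> is orthogonalized by \<open>gram_schmidt\<close>,
  which keeps the first vector. Dividing each vector by its Euclidean length makes the columns
  orthonormal and changes \<open>v\<close> only by the scalar \<open>c\<close>.\<close>

lemma unitary_extension:
  fixes v :: "complex vec"
  assumes v: "v \<in> carrier_vec n" "v \<noteq> 0\<^sub>v n"
  obtains W c where "W \<in> carrier_mat n n" "adj W * W = 1\<^sub>m n" "col W 0 = c \<cdot>\<^sub>v v"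
proof -
  interpret cof_vec_space n "TYPE(complex)" .
  define b where "b = basis_completion v"
  define ws where "ws = gram_schmidt n b"
  note bc = basis_completion[OF v, folded b_def]
  have n: "n > 0"
    using v by (cases n) auto
  have "b = v # tl b" using bc(6,7) n by (cases b) auto
  then have hdws: "hd ws = v" using gram_schmidt_hd[OF v(1)] unfolding ws_def by metis
  note gs = gram_schmidt_result[OF bc(2,4,5) ws_def]
  have len: "length ws = n" using gs(4) bc(6) by simp
  have wsc: "ws ! i \<in> carrier_vec n" if "i < n" for i using gs(3) that len by auto
  have ws0: "ws ! 0 = v" using hdws len n by (metis hd_conv_nth length_greater_0_conv)
  define r where "r i = sqrt (\<Sum>k<n. (cmod (ws ! i $ k))\<^sup>2)" for i
  have sq: "ws ! i \<bullet>c ws ! i = complex_of_real ((r i)\<^sup>2)" if "i < n" for i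
    using wsc[OF that]
    by (simp add: r_def scalar_prod_def sum_nonneg complex_norm_square atLeast0LessThan del: of_real_power)
  \<comment> \<open>\<open>corthogonal\<close> says that an inner product vanishes exactly when the
    indices differ, so no vector has length zero.\<close>
  have r0: "r i \<noteq> 0" if "i < n" for i
    using corthogonalD[OF gs(2), of i i] sq[OF that] that len by auto
  define W where "W = mat n n (\<lambda>(k, i). ws ! i $ k / complex_of_real (r i))"
  have W: "W \<in> carrier_mat n n" by (simp add: W_def)
  have "adj W * W = 1\<^sub>m n"
  proof (rule eq_matI)
    fix i j assume "i < dim_row (1\<^sub>m n)" "j < dim_col (1\<^sub>m n)"
    then have ij: "i < n" "j < n" by auto
    have "(adj W * W) $$ (i, j) = (\<Sum>k<n. cnj (ws ! i $ k) * (ws ! j $ k)) / complex_of_real (r i * r j)"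
      using ij W by (simp add: scalar_prod_def W_def sum_divide_distrib atLeast0LessThan)
    also have "(\<Sum>k<n. cnj (ws ! i $ k) * (ws ! j $ k)) = ws ! j \<bullet>c ws ! i"
      using wsc[OF ij(1)] wsc[OF ij(2)]
      by (simp add: scalar_prod_def atLeast0LessThan mult.commute)
    also have "\<dots> / complex_of_real (r i * r j) = (if i = j then 1 else 0)"
      using sq[OF ij(1)] r0[OF ij(1)] corthogonalD[OF gs(2), of j i] ij len
      by (auto simp: power2_eq_square)
    finally show "(adj W * W) $$ (i, j) = 1\<^sub>m n $$ (i, j)" using ij by simp
  qed (use W in auto)
  moreover have "col W 0 = complex_of_real (1 / r 0) \<cdot>\<^sub>v v"
    using n v by (intro eq_vecI) (auto simp: W_def ws0)
  ultimately show ?thesis using that W by blast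
qed

lemma adj_four_block:
  assumes "X \<in> carrier_mat a b" "Y \<in> carrier_mat a c" "Z \<in> carrier_mat d b" "T \<in> carrier_mat d c"
  shows "adj (four_block_mat X Y Z T) = four_block_mat (adj X) (adj Z) (adj Y) (adj T)"
  using assms by (intro eq_matI) auto

text \<open>Induction on \<open>es\<close>: a unitary matrix whose first column is a multiple of an
  eigenvector splits off \<open>e\<close>, and the remaining block is treated recursively. Following
  the list puts the eigenvalues on the diagonal in any prescribed order, in particular the sorted
  one.\<close>

theorem unitary_schur_decomposition:
  assumes "A \<in> carrier_mat n n" "char_poly A = (\<Prod>e\<leftarrow>es. [:- e, 1:])"
  shows "\<exists>U\<in>carrier_mat n n. adj U * U = 1\<^sub>m n \<and> upper_triangular (adj U * A * U) \<and>
    diag_mat (adj U * A * U) = es"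
  using assms
proof (induction es arbitrary: n A)
  case Nil
  then have "n = 0" using degree_monic_char_poly[of A n] by simp
  then show ?case using Nil by (intro bexI[of _ "1\<^sub>m 0"]) (auto simp: diag_mat_def)
next
  case (Cons e es)
  note A = Cons.prems(1)
  define m where "m = n - 1"
  \<comment> \<open>Comparing degrees shows that \<open>n\<close> is positive; \<open>m\<close> is
    the size of the block left after splitting off \<open>e\<close>.\<close>
  have mon: "monic (\<Prod>e\<leftarrow>es. [:- e, 1:])" by (rule monic_prod_list) auto
  then have "degree (char_poly A) = Suc (degree (\<Prod>e\<leftarrow>es. [:- e, 1:]))"
    unfolding Cons.prems(2) by (simp del: mult_pCons_left, subst degree_mult_eq) auto
  then have n: "n = Suc m" using degree_monic_char_poly[OF A] by (simp add: m_def)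
  have "eigenvalue A e" unfolding eigenvalue_root_char_poly[OF A] Cons.prems(2) by simp
  then obtain v where v: "v \<in> carrier_vec n" "v \<noteq> 0\<^sub>v n" "A *\<^sub>v v = e \<cdot>\<^sub>v v"
    using A by (auto simp: eigenvalue_def eigenvector_def)
  obtain W c where W: "W \<in> carrier_mat n n" "adj W * W = 1\<^sub>m n" "col W 0 = c \<cdot>\<^sub>v v"
    using unitary_extension[OF v(1,2)] by blast
  have WW: "W * adj W = 1\<^sub>m n"
    by (rule mat_mult_left_right_inverse[OF _ W(1,2)]) (use W(1) in simp)
  define B where "B = adj W * A * W"
  have B: "B \<in> carrier_mat n n" 
    unfolding B_def using A W(1) by (meson adj_carrier mult_carrier_mat)
  have "similar_mat_wit B A (adj W) W"
    using A W WW B by (intro similar_mat_witI[of _ _ n]) (auto simp: B_def)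
  then have cpB: "char_poly B = char_poly A"
    by (intro char_poly_similar) (auto simp: similar_mat_def)
  have aW: "adj W \<in> carrier_mat n n" and cW: "col W 0 \<in> carrier_vec n" using W(1) by auto
  \<comment> \<open>\<open>A\<close> scales \<open>col W 0\<close>, a multiple of \<open>v\<close>,
    by \<open>e\<close>; and \<open>adj W\<close> sends this column to the first unit vector because
    \<open>adj W * W\<close> is the identity.\<close>
  have "col B 0 = (adj W * A) *\<^sub>v col W 0"
    unfolding B_def using n by (intro col_mult2[OF mult_carrier_mat[OF aW A] W(1)]) simp
  also have "\<dots> = adj W *\<^sub>v (A *\<^sub>v col W 0)"
    by (rule assoc_mult_mat_vec[OF aW A cW])
  also have "A *\<^sub>v col W 0 = e \<cdot>\<^sub>v col W 0"
    using v mult_mat_vec[OF A v(1), of c] by (simp add: W(3) smult_smult_assoc mult.commute)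
  also have "adj W *\<^sub>v (e \<cdot>\<^sub>v col W 0) = e \<cdot>\<^sub>v (adj W *\<^sub>v col W 0)"
    by (rule mult_mat_vec[OF aW cW])
  also have "adj W *\<^sub>v col W 0 = unit_vec n 0"
    using n col_mult2[OF aW W(1), of 0] by (simp add: W(2))
  finally have colB: "col B 0 = e \<cdot>\<^sub>v unit_vec n 0" .
  obtain A1 A2 A0 A3 where split: "split_block B 1 1 = (A1, A2, A0, A3)"
    by (cases "split_block B 1 1")
  have "dim_row B = 1 + m" "dim_col B = 1 + m" using B n by auto
  note sb = split_block[OF split this]
  have B0: "B $$ (i, 0) = (if i = 0 then e else 0)" if "i < n" for i
    using arg_cong[OF colB, of "\<lambda>v. v $ i"] that B n by auto
  have A1: "A1 = mat 1 1 (\<lambda>_. e)" and A0: "A0 = 0\<^sub>m m 1"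
    using split B0 B n by (auto simp: split_block_def Let_def)
  have cpA1: "char_poly A1 = [:- e, 1:]"
    by (simp add: A1 char_poly_defs det_def sign_def)
  have "char_poly B = char_poly A1 * char_poly A3"
    unfolding sb(5) A0 by (rule char_poly_four_block_zeros_col[OF sb(1,2,4)])
  \<comment> \<open>Cancelling the factor of the 1-by-1 corner gives \<open>A3\<close> the
    factorization that the induction hypothesis requires.\<close>
  then have "[:- e, 1:] * char_poly A3 = [:- e, 1:] * (\<Prod>e\<leftarrow>es. [:- e, 1:])"
    using cpB Cons.prems(2) cpA1 by simp
  then have "char_poly A3 = (\<Prod>e\<leftarrow>es. [:- e, 1:])"
    by (subst (asm) mult_cancel_left) auto
  from Cons.IH[OF sb(4) this] obtain P where P: "P \<in> carrier_mat m m" "adj P * P = 1\<^sub>m m"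
    "upper_triangular (adj P * A3 * P)" "diag_mat (adj P * A3 * P) = es" by blast
  \<comment> \<open>Bordering \<open>P\<close> by a 1 keeps it unitary; conjugation by
    \<open>F\<close> triangularizes \<open>A3\<close> and preserves the zeros below the corner, so
    \<open>W * F\<close> is the required matrix.\<close>
  define F where "F = four_block_mat (1\<^sub>m 1) (0\<^sub>m 1 m) (0\<^sub>m m 1) P"
  have F: "F \<in> carrier_mat n n" using P n by (auto simp: F_def)
  have adj1: "adj (1\<^sub>m 1) = 1\<^sub>m 1" "adj (0\<^sub>m a b) = 0\<^sub>m b a" for a b by (auto intro!: eq_matI)
  have adjF: "adj F = four_block_mat (1\<^sub>m 1) (0\<^sub>m 1 m) (0\<^sub>m m 1) (adj P)"
    unfolding F_def using P by (subst adj_four_block[of _ 1 1 _ m _ m]) (auto simp: adj1)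
  have FF: "adj F * F = 1\<^sub>m n"
    unfolding adjF unfolding F_def using P n
    by (subst mult_four_block_mat[of _ 1 1 _ m _ m _ _ 1 _ m]) auto
  have AF: "adj F * B * F = four_block_mat A1 (A2 * P) (0\<^sub>m m 1) (adj P * A3 * P)"
  proof -
    have aP: "adj P * A3 \<in> carrier_mat m m" by (rule mult_carrier_mat[OF adj_carrier[OF P(1)] sb(4)])
    have "adj F * B = four_block_mat A1 A2 (0\<^sub>m m 1) (adj P * A3)"
      unfolding adjF sb(5) A0 using P(1) sb(1-4)
      by (subst mult_four_block_mat[of _ 1 1 _ m _ m _ _ 1 _ m]) auto
    then show ?thesis
      unfolding F_def using P(1) sb(1,2) aP
      by (simp only:, subst mult_four_block_mat[of _ 1 1 _ m _ m _ _ 1 _ m]) auto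
  qed
  have aF: "adj F \<in> carrier_mat n n" using F by simp
  note carr [simp] = A W(1) F aW aF mult_carrier_mat[of _ n n _ n] and assoc = assoc_mult_mat[of _ n n _ n _ n]
  have WF: "adj (W * F) * A * (W * F) = adj F * B * F"
    by (simp add: adj_mult[OF W(1) F] B_def assoc)
  have "adj (W * F) * (W * F) = adj F * (adj W * W) * F"
    by (simp add: adj_mult[OF W(1) F] assoc)
  also have "\<dots> = 1\<^sub>m n" unfolding W(2) right_mult_one_mat[OF aF] by (rule FF)
  finally have 1: "adj (W * F) * (W * F) = 1\<^sub>m n" .
  have T3: "adj P * A3 * P \<in> carrier_mat m m"
    by (rule mult_carrier_mat[OF mult_carrier_mat[OF adj_carrier[OF P(1)] sb(4)] P(1)])
  have "upper_triangular (four_block_mat A1 (A2 * P) (0\<^sub>m m 1) (adj P * A3 * P))"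
    by (rule upper_triangular_four_block[OF sb(1) T3 _ P(3)]) (auto simp: A1)
  moreover have "diag_mat (four_block_mat A1 (A2 * P) (0\<^sub>m m 1) (adj P * A3 * P)) = e # es"
    unfolding diag_four_block_mat[OF sb(1) T3] P(4) by (simp add: A1 diag_mat_def)
  ultimately show ?case
    using 1 W F by (intro bexI[of _ "W * F"]) (auto simp: WF AF)
qed

section \<open>Calculus of representatives\<close>

lemma eventually_unit_interval: "eventually (\<lambda>\<epsilon>::real. \<epsilon> \<in> {0<..1}) (at_right 0)"
  by (rule eventually_mono[OF small_at_right_0]) auto

text \<open>Moderateness depends only on the germ at \<open>0+\<close>. This form serves nets that
  are chosen only for \<open>\<epsilon> \<in> {0<..1}\<close> and are arbitrary elsewhere.\<close>

lemma moderate_eventually_bounded: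
  assumes "\<And>\<epsilon>. \<epsilon> \<in> {0<..1} \<Longrightarrow> norm (r \<epsilon>) \<le> C"
  shows "moderate r"
  unfolding moderate_def
  by (rule exI[of _ 0]) (auto intro!: bigoI[of _ C] eventually_mono[OF eventually_unit_interval] assms)

text \<open>Handles estimates whose dominating index varies with \<epsilon>: the term at that index
  is at most the sum over a fixed finite \<open>I\<close>, and such a sum of negligible nets is
  again negligible.\<close>

lemma negligible_dominated:
  fixes f :: "real \<Rightarrow> 'a::real_normed_field" and g :: "'i \<Rightarrow> real \<Rightarrow> 'b::real_normed_field"
  assumes bound: "\<And>\<epsilon>. \<epsilon> \<in> {0<..1} \<Longrightarrow> norm (f \<epsilon>) \<le> C * (\<Sum>i\<in>I. norm (g i \<epsilon>))"
    and neg: "\<And>i. i \<in> I \<Longrightarrow> negligible (g i)"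
  shows "negligible f"
  unfolding negligible_def
proof
  fix m :: nat
  have "(\<lambda>\<epsilon>. \<Sum>i\<in>I. norm (g i \<epsilon>)) \<in> O[at_right 0](\<lambda>\<epsilon>. \<epsilon> ^ m)"
    using neg by (intro big_sum_in_bigo) (auto simp: negligible_def)
  moreover have "(\<lambda>\<epsilon>. norm (f \<epsilon>)) \<in> O[at_right 0](\<lambda>\<epsilon>. \<Sum>i\<in>I. norm (g i \<epsilon>))"
    using bound
    by (auto intro!: bigoI[of _ C] eventually_mono[OF eventually_unit_interval] simp: sum_nonneg)
  ultimately show "(\<lambda>\<epsilon>. norm (f \<epsilon>)) \<in> O[at_right 0](\<lambda>\<epsilon>. \<epsilon> ^ m)"
    by (rule landau_o.big_trans[rotated])
qed

lemma negligible_dominated1: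
  fixes f :: "real \<Rightarrow> 'a::real_normed_field" and g :: "real \<Rightarrow> 'b::real_normed_field"
  assumes "\<And>\<epsilon>. \<epsilon> \<in> {0<..1} \<Longrightarrow> norm (f \<epsilon>) \<le> norm (g \<epsilon>)" "negligible g"
  shows "negligible f"
  using negligible_dominated[where f = f and C = 1 and I = "{()}" and g = "\<lambda>_. g"] assms by simp

lemma gen_rel_refl: "gen_rel r r \<longleftrightarrow> moderate r"
  by (simp add: gen_rel_def)

lemma represents_rep_gen: "represents (rep_gen x) x"
  using Quotient_rep_reflp[OF Quotient_gen] Quotient_abs_rep[OF Quotient_gen]
  by (auto simp: represents_def gen_rel_def)

lemma represents_eq_iff:
  assumes "represents r x" "represents s y"
  shows "x = y \<longleftrightarrow> negligible (\<lambda>\<epsilon>. r \<epsilon> - s \<epsilon>)"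
  using assms Quotient_rel[OF Quotient_gen, of r s] by (auto simp: represents_def gen_rel_def)

lemma represents_negligible_diff:
  assumes "represents r x" "negligible (\<lambda>\<epsilon>. r \<epsilon> - s \<epsilon>)"
  shows "represents s x"
proof -
  have "moderate r" using assms(1) by (simp add: represents_def)
  from moderate_add[OF this negligible_moderate[OF negligible_minus_commute[OF assms(2)]]]
  have "moderate s" by simp
  then have "represents s (abs_gen s)" by (simp add: represents_def)
  with represents_eq_iff[OF assms(1) this] assms(2) show ?thesis by simp
qed

text \<open>The difference vanishes on \<open>{0<..1}\<close> and is therefore negligible, so values
  elsewhere never affect the class.\<close>

lemma represents_cong:
  assumes "\<And>\<epsilon>. \<epsilon> \<in> {0<..1} \<Longrightarrow> r \<epsilon> = s \<epsilon>"
  shows "represents r x \<longleftrightarrow> represents s x"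
proof -
  have "negligible (\<lambda>\<epsilon>. r \<epsilon> - s \<epsilon>)" "negligible (\<lambda>\<epsilon>. s \<epsilon> - r \<epsilon>)"
    by (rule negligible_dominated1[of _ "\<lambda>_. 0 :: real"]; simp add: assms)+
  then show ?thesis using represents_negligible_diff[of r x s] represents_negligible_diff[of s x r] by argo
qed

lemma represents_zero: "represents (\<lambda>_. 0) 0"
  by (simp add: represents_def zero_gen_def negligible_moderate)

lemma represents_one: "represents (\<lambda>_. 1) 1"
  by (simp add: represents_def one_gen_def moderate_one)

lemma represents_add:
  "represents r x \<Longrightarrow> represents s y \<Longrightarrow> represents (\<lambda>\<epsilon>. r \<epsilon> + s \<epsilon>) (x + y)"
  by (auto simp: represents_def moderate_add plus_gen.abs_eq gen_rel_refl)

lemma represents_mult: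
  "represents r x \<Longrightarrow> represents s y \<Longrightarrow> represents (\<lambda>\<epsilon>. r \<epsilon> * s \<epsilon>) (x * y)"
  by (auto simp: represents_def moderate_mult times_gen.abs_eq gen_rel_refl)

lemma represents_diff:
  assumes "represents r x" "represents s y"
  shows "represents (\<lambda>\<epsilon>. r \<epsilon> - s \<epsilon>) (x - y)"
proof -
  have "moderate (\<lambda>\<epsilon>. r \<epsilon> - s \<epsilon>)"
    using moderate_add[OF _ moderate_uminus, of r s] assms by (simp add: represents_def)
  then show ?thesis
    using assms by (auto simp: represents_def minus_gen.abs_eq gen_rel_refl)
qed

lemma represents_sum:
  "(\<And>i. i \<in> I \<Longrightarrow> represents (r i) (x i)) \<Longrightarrow> represents (\<lambda>\<epsilon>. \<Sum>i\<in>I. r i \<epsilon>) (\<Sum>i\<in>I. x i)"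
  by (induction I rule: infinite_finite_induct) (auto simp: represents_zero represents_add)

lemma represents_cnj: "represents r x \<Longrightarrow> represents (\<lambda>\<epsilon>. cnj (r \<epsilon>)) (gen_cnj x)"
  using moderate_cong_norm[of r "\<lambda>\<epsilon>. cnj (r \<epsilon>)"]
  by (auto simp: represents_def gen_cnj.abs_eq gen_rel_refl)

lemma represents_of_real:
  "represents r x \<Longrightarrow> represents (\<lambda>\<epsilon>. complex_of_real (r \<epsilon>)) (gen_of_real x)"
proof -
  assume r: "represents r x"
  then have "moderate (\<lambda>\<epsilon>. complex_of_real (r \<epsilon>))"
    by (simp add: represents_def moderate_def)
  with r show ?thesis by (auto simp: represents_def gen_of_real.abs_eq gen_rel_refl)
qed

lemma represents_gen_char: "represents (\<lambda>\<epsilon>. if \<epsilon> \<in> S then 1 else 0) (gen_char S)"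
  by (auto simp: represents_def gen_char_def intro: moderate_bounded[of _ 1])

lemma represents_eq_zero_iff: "represents r x \<Longrightarrow> x = 0 \<longleftrightarrow> negligible r"
  using represents_eq_iff[OF _ represents_zero] by simp

section \<open>Nets of matrices: products, adjoints and uniqueness\<close>

lemma mat_represents_carrier: "mat_represents n X M \<Longrightarrow> \<epsilon> \<in> {0<..1} \<Longrightarrow> X \<epsilon> \<in> carrier_mat n n"
  by (simp add: mat_represents_def)

lemma mat_representsD:
  "mat_represents n X M \<Longrightarrow> i < n \<Longrightarrow> j < n \<Longrightarrow> represents (\<lambda>\<epsilon>. X \<epsilon> $$ (i, j)) (M $$ (i, j))"
  by (simp add: mat_represents_def)

lemma mat_represents_mult:
  assumes X: "mat_represents n X M" "M \<in> carrier_mat n n"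
    and Y: "mat_represents n Y N" "N \<in> carrier_mat n n"
  shows "mat_represents n (\<lambda>\<epsilon>. X \<epsilon> * Y \<epsilon>) (M * N)"
  unfolding mat_represents_def
proof (intro conjI ballI allI impI)
  show "X \<epsilon> * Y \<epsilon> \<in> carrier_mat n n" if "\<epsilon> \<in> {0<..1}" for \<epsilon>
    using mat_represents_carrier[OF X(1) that] mat_represents_carrier[OF Y(1) that]
    by (rule mult_carrier_mat)
next
  fix i j assume ij: "i < n" "j < n"
  have "represents (\<lambda>\<epsilon>. \<Sum>k<n. X \<epsilon> $$ (i, k) * Y \<epsilon> $$ (k, j)) (\<Sum>k<n. M $$ (i, k) * N $$ (k, j))"
    using ij by (intro represents_sum represents_mult mat_representsD[OF X(1)] mat_representsD[OF Y(1)]) auto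
  also have "(\<Sum>k<n. M $$ (i, k) * N $$ (k, j)) = (M * N) $$ (i, j)"
    using ij X(2) Y(2) by (simp add: scalar_prod_def atLeast0LessThan)
  \<comment> \<open>The dimensions of \<open>X \<epsilon>\<close> and \<open>Y \<epsilon>\<close>
    are known only for \<open>\<epsilon> \<in> {0<..1}\<close>, so the entry formula is applied
    there and \<open>represents_cong\<close> covers the rest.\<close>
  finally show "represents (\<lambda>\<epsilon>. (X \<epsilon> * Y \<epsilon>) $$ (i, j)) ((M * N) $$ (i, j))"
  proof (rule iffD1[OF represents_cong, rotated])
    fix \<epsilon> :: real assume e: "\<epsilon> \<in> {0<..1}"
    then show "(\<Sum>k<n. X \<epsilon> $$ (i, k) * Y \<epsilon> $$ (k, j)) = (X \<epsilon> * Y \<epsilon>) $$ (i, j)"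
      using mat_represents_carrier[OF X(1) e] mat_represents_carrier[OF Y(1) e] ij
      by (simp add: scalar_prod_def atLeast0LessThan)
  qed
qed

lemma gen_adjoint_carrier [simp]: "M \<in> carrier_mat n n \<Longrightarrow> gen_adjoint M \<in> carrier_mat n n"
  by (simp add: gen_adjoint_def)

lemma gen_adjoint_index [simp]:
  "i < dim_col M \<Longrightarrow> j < dim_row M \<Longrightarrow> gen_adjoint M $$ (i, j) = gen_cnj (M $$ (j, i))"
  by (simp add: gen_adjoint_def)

lemma represents_unique: "represents r x \<Longrightarrow> represents r y \<Longrightarrow> x = y"
  by (simp add: represents_def)

lemma gen_cnj_gen_cnj [simp]: "gen_cnj (gen_cnj x) = x"
  using represents_cnj[OF represents_cnj[OF represents_rep_gen[of x]]] represents_rep_gen[of x]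
  by (simp add: represents_unique)

lemma gen_cnj_zero [simp]: "gen_cnj 0 = 0"
  using represents_cnj[OF represents_zero] represents_zero[where ?'a = complex]
  by (simp add: represents_unique)

lemma comm_ring_hom_gen_cnj: "comm_ring_hom gen_cnj"
proof
  fix x y :: "complex gen"
  note xy = represents_rep_gen[of x] represents_rep_gen[of y]
  note cxy = represents_cnj[OF xy(1)] represents_cnj[OF xy(2)]
  show "gen_cnj (x + y) = gen_cnj x + gen_cnj y"
    using represents_cnj[OF represents_add[OF xy]] represents_add[OF cxy]
    by (simp add: represents_unique)
  show "gen_cnj (x * y) = gen_cnj x * gen_cnj y"
    using represents_cnj[OF represents_mult[OF xy]] represents_mult[OF cxy]
    by (simp add: represents_unique)
  show "gen_cnj 1 = 1"
    using represents_cnj[OF represents_one] represents_one[where ?'a = complex] by (simp add: represents_unique)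
qed simp

lemma gen_adjoint_mult:
  assumes "M \<in> carrier_mat n m" "N \<in> carrier_mat m k"
  shows "gen_adjoint (M * N) = gen_adjoint N * gen_adjoint M"
proof -
  interpret comm_ring_hom gen_cnj by (rule comm_ring_hom_gen_cnj)
  show ?thesis
    using assms by (simp add: gen_adjoint_def mat_hom_mult[OF assms] transpose_mult[of _ n m _ k])
qed

lemma gen_adjoint_gen_adjoint [simp]: "gen_adjoint (gen_adjoint M) = M"
  by (intro eq_matI) (auto simp: gen_adjoint_def)

lemma mat_represents_adjoint:
  assumes X: "mat_represents n X M" "M \<in> carrier_mat n n"
  shows "mat_represents n (\<lambda>\<epsilon>. adj (X \<epsilon>)) (gen_adjoint M)"
  unfolding mat_represents_def
proof (intro conjI ballI allI impI)
  show "adj (X \<epsilon>) \<in> carrier_mat n n" if "\<epsilon> \<in> {0<..1}" for \<epsilon>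
    using mat_represents_carrier[OF X(1) that] by simp
next
  fix i j assume ij: "i < n" "j < n"
  have "represents (\<lambda>\<epsilon>. cnj (X \<epsilon> $$ (j, i))) (gen_cnj (M $$ (j, i)))"
    using ij by (intro represents_cnj mat_representsD[OF X(1)])
  also have "gen_cnj (M $$ (j, i)) = gen_adjoint M $$ (i, j)" using ij X(2) by simp
  finally show "represents (\<lambda>\<epsilon>. adj (X \<epsilon>) $$ (i, j)) (gen_adjoint M $$ (i, j))"
  proof (rule iffD1[OF represents_cong, rotated])
    fix \<epsilon> :: real assume e: "\<epsilon> \<in> {0<..1}"
    then show "cnj (X \<epsilon> $$ (j, i)) = adj (X \<epsilon>) $$ (i, j)"
      using mat_represents_carrier[OF X(1) e] ij by simp
  qed
qed

text \<open>Carries matrix identities that hold at each \<epsilon>, such as unitarity, over to the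
  generalized matrices.\<close>

lemma mat_represents_unique:
  assumes "mat_represents n X M" "mat_represents n Y N"
    and "M \<in> carrier_mat n n" "N \<in> carrier_mat n n"
    and "\<And>\<epsilon>. \<epsilon> \<in> {0<..1} \<Longrightarrow> X \<epsilon> = Y \<epsilon>"
  shows "M = N"
proof (rule eq_matI)
  fix i j assume "i < dim_row N" "j < dim_col N"
  then have "i < n" "j < n" using assms by auto
  then have "represents (\<lambda>\<epsilon>. X \<epsilon> $$ (i, j)) (M $$ (i, j))"
    "represents (\<lambda>\<epsilon>. Y \<epsilon> $$ (i, j)) (N $$ (i, j))"
    by (auto intro: mat_representsD assms(1,2))
  moreover have "represents (\<lambda>\<epsilon>. X \<epsilon> $$ (i, j)) x \<longleftrightarrow> represents (\<lambda>\<epsilon>. Y \<epsilon> $$ (i, j)) x" for x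
    by (rule represents_cong) (simp add: assms(5))
  ultimately show "M $$ (i, j) = N $$ (i, j)" by (simp add: represents_def)
qed (use assms in auto)

lemma mat_represents_one: "mat_represents n (\<lambda>_. 1\<^sub>m n) (1\<^sub>m n)"
  by (auto simp: mat_represents_def represents_one represents_zero)

section \<open>Comparing sorted spectra\<close>

text \<open>Each column has Euclidean norm 1. The bound makes unitary nets moderate and controls the
  factors in the Leibniz formula.\<close>

lemma unitary_entry_le_1:
  assumes V: "V \<in> carrier_mat n n" "adj V * V = 1\<^sub>m n" and ij: "i < n" "j < n"
  shows "cmod (V $$ (i, j)) \<le> 1"
proof -
  have "complex_of_real (\<Sum>k<n. (cmod (V $$ (k, j)))\<^sup>2) = (adj V * V) $$ (j, j)"
    using V(1) ij by (simp add: scalar_prod_def atLeast0LessThan complex_norm_square mult.commute del: of_real_power)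
  also have "\<dots> = complex_of_real 1" using V(2) ij by simp
  finally have "(\<Sum>k<n. (cmod (V $$ (k, j)))\<^sup>2) = 1" by (simp only: of_real_eq_iff)
  moreover have "(cmod (V $$ (i, j)))\<^sup>2 \<le> (\<Sum>k<n. (cmod (V $$ (k, j)))\<^sup>2)"
    using ij by (intro member_le_sum) auto
  ultimately show ?thesis by (simp add: power_le_one_iff)
qed

lemma unitary_det_norm:
  assumes V: "V \<in> carrier_mat n n" "adj V * V = 1\<^sub>m n"
  shows "cmod (det V) = 1"
proof -
  interpret cnj: comm_ring_hom cnj by unfold_locales auto
  have "det (adj V) = cnj (det V)"
    unfolding adj_def using V(1) by (subst det_transpose[of _ n]) auto
  then have "cnj (det V) * det V = 1"
    using det_mult[OF adj_carrier[OF V(1)] V(1)] V(2) by simp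
  then have "cmod (cnj (det V) * det V) = 1" by simp
  then have "(cmod (det V))\<^sup>2 = 1\<^sup>2" by (simp add: norm_mult power2_eq_square)
  then show ?thesis by (rule power2_eq_imp_eq) auto
qed

text \<open>Otherwise every permutation would meet an entry of modulus below
  \<open>1 / fact n\<close>. The other factors being at most 1, each of the \<open>fact n\<close>
  Leibniz terms would be that small, forcing the determinant to have modulus below 1.\<close>

lemma unitary_large_transversal:
  assumes V: "V \<in> carrier_mat n n" "adj V * V = 1\<^sub>m n"
  obtains p where "p permutes {0..<n}" "\<And>i. i < n \<Longrightarrow> 1 \<le> fact n * cmod (V $$ (i, p i))"
proof -
  let ?P = "{p. p permutes {0..<n}}"
  have "\<exists>p\<in>?P. \<forall>i<n. 1 \<le> fact n * cmod (V $$ (i, p i))"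
  proof (rule ccontr)
    assume none: "\<not> ?thesis"
    have small: "cmod (signof p * (\<Prod>i = 0..<n. V $$ (i, p i))) < 1 / fact n" if p: "p \<in> ?P" for p
    proof -
      from none p obtain i where i: "i < n" "fact n * cmod (V $$ (i, p i)) < 1" by force
      have "cmod (signof p * (\<Prod>i = 0..<n. V $$ (i, p i))) = (\<Prod>i = 0..<n. cmod (V $$ (i, p i)))"
        by (simp add: norm_mult prod_norm sign_def)
      also have "\<dots> = cmod (V $$ (i, p i)) * (\<Prod>j\<in>{0..<n} - {i}. cmod (V $$ (j, p j)))"
        using i by (subst prod.remove[of _ i]) auto
      also have "\<dots> \<le> cmod (V $$ (i, p i)) * 1"
        using p permutes_in_image[of p "{0..<n}"]
        by (intro mult_left_mono prod_le_1) (auto intro!: unitary_entry_le_1[OF V])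
      also have "\<dots> < 1 / fact n" using i by (simp add: field_simps)
      finally show ?thesis .
    qed
    have fin: "finite ?P" by (simp add: finite_permutations)
    have "cmod (det V) \<le> (\<Sum>p\<in>?P. cmod (signof p * (\<Prod>i = 0..<n. V $$ (i, p i))))"
      unfolding det_def'[OF V(1)] by (rule norm_sum)
    also have "\<dots> < (\<Sum>p\<in>?P. 1 / fact n)"
      using small permutes_id by (intro sum_strict_mono[OF fin]) blast+
    also have "\<dots> = 1" by (simp add: card_permutations)
    finally show False using unitary_det_norm[OF V] by simp
  qed
  then show ?thesis using that by blast
qed

text \<open>A pigeonhole argument: if the bound failed at \<open>k\<close>, then every
  \<open>i \<le> k\<close> would be matched to a value of \<open>b\<close> above \<open>b k\<close>,
  hence to an index below \<open>k\<close>. So \<open>p\<close> would map \<open>k + 1\<close>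
  indices injectively into \<open>k\<close>.\<close>

lemma sorted_le_of_matching:
  fixes a b :: "nat \<Rightarrow> real"
  assumes a: "\<And>i j. i \<le> j \<Longrightarrow> j < n \<Longrightarrow> a j \<le> a i"
    and b: "\<And>i j. i \<le> j \<Longrightarrow> j < n \<Longrightarrow> b j \<le> b i"
    and p: "p permutes {0..<n}"
    and d: "\<And>i. i < n \<Longrightarrow> a i \<le> b (p i) + d"
    and k: "k < n"
  shows "a k \<le> b k + d"
proof (rule ccontr)
  assume "\<not> ?thesis"
  then have gt: "b k < a k - d" by simp
  have "p i < k" if "i \<le> k" for i
  proof (rule ccontr)
    assume "\<not> p i < k"
    moreover have "p i < n" using permutes_in_image[OF p, of i] that k by simp
    ultimately have "b (p i) \<le> b k" using b by simp
    with gt d[of i] a[of i k] that k show False by linarith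
  qed
  then have "p ` {..k} \<subseteq> {..<k}" by auto
  then have "card (p ` {..k}) \<le> k" using card_mono[of "{..<k}"] by fastforce
  moreover have "card (p ` {..k}) = Suc k"
    using card_image[OF inj_on_subset[OF permutes_inj[OF p]], of "{..k}"] by simp
  ultimately show False by simp
qed

lemma sorted_dist_le_of_matching:
  fixes a b :: "nat \<Rightarrow> real"
  assumes a: "\<And>i j. i \<le> j \<Longrightarrow> j < n \<Longrightarrow> a j \<le> a i"
    and b: "\<And>i j. i \<le> j \<Longrightarrow> j < n \<Longrightarrow> b j \<le> b i"
    and p: "p permutes {0..<n}"
    and d: "\<And>i. i < n \<Longrightarrow> \<bar>a i - b (p i)\<bar> \<le> d"
    and k: "k < n"
  shows "\<bar>a k - b k\<bar> \<le> d"
proof -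
  have "a k \<le> b k + d"
    using sorted_le_of_matching[OF a b p _ k, where d = d] d by force
  \<comment> \<open>The reverse bound exchanges the two sequences and uses the inverse
    matching.\<close>
  moreover have "b k \<le> a k + d"
  proof (rule sorted_le_of_matching[OF b a permutes_inv[OF p] _ k])
    fix i assume i: "i < n"
    have "inv_into UNIV p i < n" using permutes_in_image[OF permutes_inv[OF p], of i] i by simp
    from d[OF this] show "b i \<le> a (inv_into UNIV p i) + d"
      by (simp add: permutes_inverses[OF p])
  qed
  ultimately show ?thesis by linarith
qed

lemma ordered_eigenvalues_unitary:
  assumes M: "M \<in> carrier_mat n n" and l: "ordered_eigenvalues n M l"
  obtains U where "U \<in> carrier_mat n n" "adj U * U = 1\<^sub>m n" "U * adj U = 1\<^sub>m n"
    "\<And>i j. j < i \<Longrightarrow> i < n \<Longrightarrow> (adj U * M * U) $$ (i, j) = 0"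
    "\<And>i. i < n \<Longrightarrow> (adj U * M * U) $$ (i, i) = l i"
proof -
  \<comment> \<open>The characteristic polynomial is monic, so it is the product of its linear
    factors without a leading constant; these can be listed in the order of
    \<open>l\<close>.\<close>
  have "char_poly M = (\<Prod>x\<in>#proots (char_poly M). [:- x, 1:])"
    using complex_poly_decompose_multiset[of "char_poly M"] degree_monic_char_poly[OF M] by simp
  also have "\<dots> = (\<Prod>e\<leftarrow>map l [0..<n]. [:- e, 1:])"
    using l unfolding ordered_eigenvalues_def
    by (metis mset_map prod_mset_prod_list)
  finally obtain U where U: "U \<in> carrier_mat n n" "adj U * U = 1\<^sub>m n"
    "upper_triangular (adj U * M * U)" "diag_mat (adj U * M * U) = map l [0..<n]"
    using unitary_schur_decomposition[OF M] by metis
  have T: "adj U * M * U \<in> carrier_mat n n"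
    by (rule mult_carrier_mat[OF mult_carrier_mat[OF adj_carrier[OF U(1)] M] U(1)])
  have "(adj U * M * U) $$ (i, i) = l i" if "i < n" for i
    using arg_cong[OF U(4), of "\<lambda>xs. xs ! i"] that U(1) by (simp add: diag_mat_def)
  moreover have "(adj U * M * U) $$ (i, j) = 0" if "j < i" "i < n" for i j
    using U(3) that T by (intro upper_triangularD) auto
  moreover have "U * adj U = 1\<^sub>m n"
    by (rule mat_mult_left_right_inverse[OF _ U(1,2)]) (use U(1) in simp)
  ultimately show ?thesis using that U by blast
qed

section \<open>Diagonalization over the generalized numbers\<close>

text \<open>Besides \<open>U\<close>, the net \<open>Y\<close> is returned with exact unitarity at
  every \<epsilon>; the comparison of two spectra needs this pointwise information.\<close>

lemma gen_hermitian_diagonalization: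
  assumes A: "A \<in> carrier_mat n n" "gen_hermitian A"
    and rep: "mat_represents n X A"
    and eig: "\<And>\<epsilon>. \<epsilon> \<in> {0<..1} \<Longrightarrow> ordered_eigenvalues n (X \<epsilon>) (\<lambda>k. ev k \<epsilon>)"
  obtains Y U where "U \<in> carrier_mat n n" "mat_represents n Y U"
    "\<And>\<epsilon>. \<epsilon> \<in> {0<..1} \<Longrightarrow> adj (Y \<epsilon>) * Y \<epsilon> = 1\<^sub>m n"
    "\<And>\<epsilon>. \<epsilon> \<in> {0<..1} \<Longrightarrow> Y \<epsilon> * adj (Y \<epsilon>) = 1\<^sub>m n"
    "gen_adjoint U * U = 1\<^sub>m n" "U * gen_adjoint U = 1\<^sub>m n"
    "gen_adjoint U * A * U = mat_diag n (\<lambda>k. gen_of_real (abs_gen (\<lambda>\<epsilon>. Re (ev k \<epsilon>))))"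
    "\<And>k. k < n \<Longrightarrow> represents (\<lambda>\<epsilon>. Re (ev k \<epsilon>)) (abs_gen (\<lambda>\<epsilon>. Re (ev k \<epsilon>)))"
    "\<And>k. k < n \<Longrightarrow> represents (ev k) (gen_of_real (abs_gen (\<lambda>\<epsilon>. Re (ev k \<epsilon>))))"
proof -
  have "\<forall>\<epsilon>\<in>{0<..1}. \<exists>V. V \<in> carrier_mat n n \<and> adj V * V = 1\<^sub>m n \<and> V * adj V = 1\<^sub>m n \<and>
      (\<forall>i<n. \<forall>j<i. (adj V * X \<epsilon> * V) $$ (i, j) = 0) \<and>
      (\<forall>i<n. (adj V * X \<epsilon> * V) $$ (i, i) = ev i \<epsilon>)"
  proof
    fix \<epsilon> :: real assume e: "\<epsilon> \<in> {0<..1}"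
    show "\<exists>V. V \<in> carrier_mat n n \<and> adj V * V = 1\<^sub>m n \<and> V * adj V = 1\<^sub>m n \<and>
      (\<forall>i<n. \<forall>j<i. (adj V * X \<epsilon> * V) $$ (i, j) = 0) \<and>
      (\<forall>i<n. (adj V * X \<epsilon> * V) $$ (i, i) = ev i \<epsilon>)"
      using ordered_eigenvalues_unitary[OF mat_represents_carrier[OF rep e] eig[OF e]] by metis
  qed
  from bchoice[OF this] obtain Y where Y: "\<And>\<epsilon>. \<epsilon> \<in> {0<..1} \<Longrightarrow> Y \<epsilon> \<in> carrier_mat n n"
    "\<And>\<epsilon>. \<epsilon> \<in> {0<..1} \<Longrightarrow> adj (Y \<epsilon>) * Y \<epsilon> = 1\<^sub>m n"
    "\<And>\<epsilon>. \<epsilon> \<in> {0<..1} \<Longrightarrow> Y \<epsilon> * adj (Y \<epsilon>) = 1\<^sub>m n"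
    "\<And>\<epsilon> i j. \<epsilon> \<in> {0<..1} \<Longrightarrow> j < i \<Longrightarrow> i < n \<Longrightarrow> (adj (Y \<epsilon>) * X \<epsilon> * Y \<epsilon>) $$ (i, j) = 0"
    "\<And>\<epsilon> i. \<epsilon> \<in> {0<..1} \<Longrightarrow> i < n \<Longrightarrow> (adj (Y \<epsilon>) * X \<epsilon> * Y \<epsilon>) $$ (i, i) = ev i \<epsilon>"
    by blast
  define U where "U = mat n n (\<lambda>ij. abs_gen (\<lambda>\<epsilon>. Y \<epsilon> $$ ij))"
  have U: "U \<in> carrier_mat n n" by (simp add: U_def)
  have YU: "mat_represents n Y U"
    unfolding mat_represents_def
  proof (intro conjI ballI allI impI)
    fix i j assume ij: "i < n" "j < n"
    \<comment> \<open>\<open>Y\<close> comes from a choice made separately at each \<epsilon>; only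
      the uniform bound on unitary entries makes its entries define generalized numbers.\<close>
    have "moderate (\<lambda>\<epsilon>. Y \<epsilon> $$ (i, j))"
      by (rule moderate_eventually_bounded[of _ 1]) (rule unitary_entry_le_1[OF Y(1,2) ij])
    then show "represents (\<lambda>\<epsilon>. Y \<epsilon> $$ (i, j)) (U $$ (i, j))"
      using ij by (simp add: represents_def U_def)
  qed (rule Y(1))
  note aU = gen_adjoint_carrier[OF U] and aYU = mat_represents_adjoint[OF YU U]
  have UU: "gen_adjoint U * U = 1\<^sub>m n"
    by (rule mat_represents_unique[OF mat_represents_mult[OF aYU aU YU U] mat_represents_one
          mult_carrier_mat[OF aU U] one_carrier_mat]) (rule Y(2))
  have UU': "U * gen_adjoint U = 1\<^sub>m n"
    by (rule mat_represents_unique[OF mat_represents_mult[OF YU U aYU aU] mat_represents_one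
          mult_carrier_mat[OF U aU] one_carrier_mat]) (rule Y(3))
  define T where "T = gen_adjoint U * A * U"
  have T: "T \<in> carrier_mat n n"
    unfolding T_def by (rule mult_carrier_mat[OF mult_carrier_mat[OF aU A(1)] U])
  have repT: "mat_represents n (\<lambda>\<epsilon>. adj (Y \<epsilon>) * X \<epsilon> * Y \<epsilon>) T"
    unfolding T_def
    by (rule mat_represents_mult[OF mat_represents_mult[OF aYU aU rep A(1)] mult_carrier_mat[OF aU A(1)] YU U])
  have adjT: "gen_adjoint T = T"
    unfolding T_def using A(2) gen_adjoint_mult[OF mult_carrier_mat[OF aU A(1)] U]
      gen_adjoint_mult[OF aU A(1)] assoc_mult_mat[OF aU A(1) U]
    by (simp add: gen_hermitian_def)
  \<comment> \<open>No growth condition on the eigenvalues was assumed: their moderateness is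
    inherited from the diagonal entries of the net representing \<open>T\<close>.\<close>
  have diag: "represents (ev i) (T $$ (i, i))" if "i < n" for i
    using iffD1[OF represents_cong mat_representsD[OF repT that that]] Y(5)[OF _ that] by simp
  have low: "T $$ (i, j) = 0" if ij: "j < i" "i < n" for i j
  proof -
    have "represents (\<lambda>_. 0) (T $$ (i, j))"
      using iffD1[OF represents_cong mat_representsD[OF repT, of i j]] Y(4)[OF _ ij] ij by simp
    then show ?thesis using represents_zero by (rule represents_unique)
  qed
  have herm: "T $$ (i, j) = gen_cnj (T $$ (j, i))" if "i < n" "j < n" for i j
    using arg_cong[OF adjT, of "\<lambda>M. M $$ (i, j)"] that T by simp
  have up: "T $$ (i, j) = 0" if ij: "i < j" "j < n" for i j
    using herm[of i j] low[OF ij] ij by simp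
  have real: "represents (\<lambda>\<epsilon>. complex_of_real (Re (ev i \<epsilon>))) (T $$ (i, i))" if i: "i < n" for i
  proof (rule represents_negligible_diff[OF diag[OF i]])
    have "represents (\<lambda>\<epsilon>. cnj (ev i \<epsilon>)) (T $$ (i, i))"
      using represents_cnj[OF diag[OF i]] herm[OF i i] by simp
    then have "negligible (\<lambda>\<epsilon>. ev i \<epsilon> - cnj (ev i \<epsilon>))"
      using represents_eq_iff[OF diag[OF i]] by blast
    \<comment> \<open>The two sides are the modulus of the imaginary part of \<open>z\<close> and
      twice that modulus.\<close>
    moreover have "cmod (z - complex_of_real (Re z)) \<le> cmod (z - cnj z)" for z
      by (auto simp: cmod_def intro!: real_le_rsqrt)
    ultimately show "negligible (\<lambda>\<epsilon>. ev i \<epsilon> - complex_of_real (Re (ev i \<epsilon>)))"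
      by (rule negligible_dominated1[rotated])
  qed
  have re: "represents (\<lambda>\<epsilon>. Re (ev i \<epsilon>)) (abs_gen (\<lambda>\<epsilon>. Re (ev i \<epsilon>)))" if "i < n" for i
    using real[OF that] by (simp add: represents_def moderate_def)
  have Tii: "T $$ (i, i) = gen_of_real (abs_gen (\<lambda>\<epsilon>. Re (ev i \<epsilon>)))" if "i < n" for i
    using represents_of_real[OF re[OF that]] real[OF that] by (simp add: represents_def)
  have "T = mat_diag n (\<lambda>k. gen_of_real (abs_gen (\<lambda>\<epsilon>. Re (ev k \<epsilon>))))"
  proof (rule eq_matI)
    fix i j assume "i < dim_row (mat_diag n (\<lambda>k. gen_of_real (abs_gen (\<lambda>\<epsilon>. Re (ev k \<epsilon>)))))"
      "j < dim_col (mat_diag n (\<lambda>k. gen_of_real (abs_gen (\<lambda>\<epsilon>. Re (ev k \<epsilon>)))))"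
    then have "i < n" "j < n" by (auto simp: mat_diag_def)
    then show "T $$ (i, j) = mat_diag n (\<lambda>k. gen_of_real (abs_gen (\<lambda>\<epsilon>. Re (ev k \<epsilon>)))) $$ (i, j)"
      using low[of j i] up[of i j] Tii[of i] by (cases i j rule: linorder_cases) (auto simp: mat_diag_def)
  qed (use T in \<open>auto simp: mat_diag_def\<close>)
  then show ?thesis
    using that[OF U YU Y(2,3) UU UU'] re diag Tii unfolding T_def by simp
qed

section \<open>Independence of the representative\<close>

lemma sorted_spectrum_unique:
  fixes a b :: "nat \<Rightarrow> real \<Rightarrow> real"
  assumes A: "A \<in> carrier_mat n n"
    and U: "U \<in> carrier_mat n n" "mat_represents n Y U" "\<And>\<epsilon>. \<epsilon> \<in> {0<..1} \<Longrightarrow> Y \<epsilon> * adj (Y \<epsilon>) = 1\<^sub>m n"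
      "U * gen_adjoint U = 1\<^sub>m n" "gen_adjoint U * A * U = mat_diag n (\<lambda>k. gen_of_real (l k))"
      "\<And>k. k < n \<Longrightarrow> represents (a k) (l k)"
    and V: "V \<in> carrier_mat n n" "mat_represents n Z V" "\<And>\<epsilon>. \<epsilon> \<in> {0<..1} \<Longrightarrow> adj (Z \<epsilon>) * Z \<epsilon> = 1\<^sub>m n"
      "V * gen_adjoint V = 1\<^sub>m n" "gen_adjoint V * A * V = mat_diag n (\<lambda>k. gen_of_real (m k))"
      "\<And>k. k < n \<Longrightarrow> represents (b k) (m k)"
    and a: "\<And>\<epsilon> i j. \<epsilon> \<in> {0<..1} \<Longrightarrow> i \<le> j \<Longrightarrow> j < n \<Longrightarrow> a j \<epsilon> \<le> a i \<epsilon>"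
    and b: "\<And>\<epsilon> i j. \<epsilon> \<in> {0<..1} \<Longrightarrow> i \<le> j \<Longrightarrow> j < n \<Longrightarrow> b j \<epsilon> \<le> b i \<epsilon>"
    and k: "k < n"
  shows "l k = m k"
proof -
  note aU = gen_adjoint_carrier[OF U(1)] and aV = gen_adjoint_carrier[OF V(1)]
  define Q where "Q = gen_adjoint U * V"
  have Q: "Q \<in> carrier_mat n n" unfolding Q_def by (rule mult_carrier_mat[OF aU V(1)])
  note carr [simp] = A U(1) V(1) aU aV mult_carrier_mat[of _ n n _ n] and assoc = assoc_mult_mat[of _ n n _ n _ n]
  \<comment> \<open>Both products equal \<open>gen_adjoint U * A * V\<close>, since
    \<open>U * gen_adjoint U\<close> and \<open>V * gen_adjoint V\<close> are the identity.\<close>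
  have "mat_diag n (\<lambda>k. gen_of_real (l k)) * Q = gen_adjoint U * A * (U * gen_adjoint U) * V"
    unfolding Q_def U(5)[symmetric] by (simp add: assoc)
  also have "\<dots> = gen_adjoint U * (V * gen_adjoint V) * A * V"
    by (simp add: U(4) V(4) right_mult_one_mat[of _ n n])
  also have "\<dots> = Q * mat_diag n (\<lambda>k. gen_of_real (m k))"
    unfolding Q_def V(5)[symmetric] by (simp add: assoc)
  finally have comm: "mat_diag n (\<lambda>k. gen_of_real (l k)) * Q = Q * mat_diag n (\<lambda>k. gen_of_real (m k))" .
  define W where "W \<epsilon> = adj (Y \<epsilon>) * Z \<epsilon>" for \<epsilon>
  have W: "mat_represents n W Q"
    unfolding W_def Q_def by (rule mat_represents_mult[OF mat_represents_adjoint[OF U(2,1)] aU V(2,1)])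
  have WW: "adj (W \<epsilon>) * W \<epsilon> = 1\<^sub>m n" if e: "\<epsilon> \<in> {0<..1}" for \<epsilon>
  proof -
    note Y = mat_represents_carrier[OF U(2) e] and Z = mat_represents_carrier[OF V(2) e]
    note aY = adj_carrier[OF Y] and aZ = adj_carrier[OF Z]
    have "adj (W \<epsilon>) = adj (Z \<epsilon>) * Y \<epsilon>"
      unfolding W_def using adj_mult[OF aY Z] by simp
    then have "adj (W \<epsilon>) * W \<epsilon> = adj (Z \<epsilon>) * (Y \<epsilon> * adj (Y \<epsilon>)) * Z \<epsilon>"
      unfolding W_def using Y Z aY aZ by (simp add: assoc_mult_mat[of _ n n _ n _ n] mult_carrier_mat[of _ n n _ n])
    also have "\<dots> = 1\<^sub>m n"
      unfolding U(3)[OF e] right_mult_one_mat[OF aZ] by (rule V(3)[OF e])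
    finally show ?thesis .
  qed
  \<comment> \<open>This net represents entry \<open>ij\<close> of the difference of the two
    products in \<open>comm\<close>, hence is negligible.\<close>
  define g where "g ij \<epsilon> = (complex_of_real (a (fst ij) \<epsilon>) - complex_of_real (b (snd ij) \<epsilon>)) * W \<epsilon> $$ ij" for ij \<epsilon>
  let ?I = "{..<n} \<times> {..<n}"
  have g: "negligible (g ij)" if "ij \<in> ?I" for ij
  proof -
    obtain i j where ij: "ij = (i, j)" "i < n" "j < n" using \<open>ij \<in> ?I\<close> by auto
    have "gen_of_real (l i) * Q $$ (i, j) = Q $$ (i, j) * gen_of_real (m j)"
      using arg_cong[OF comm, of "\<lambda>M. M $$ (i, j)"] ij
      by (simp add: mat_diag_mult_left[OF Q] mat_diag_mult_right[OF Q])
    then have "(gen_of_real (l i) - gen_of_real (m j)) * Q $$ (i, j) = 0" by (simp add: algebra_simps)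
    moreover have "represents (g ij) ((gen_of_real (l i) - gen_of_real (m j)) * Q $$ (i, j))"
      unfolding g_def ij(1) fst_conv snd_conv
      using ij U(6) V(6) by (intro represents_mult represents_diff represents_of_real mat_representsD[OF W])
    ultimately show ?thesis using represents_eq_zero_iff by blast
  qed
  \<comment> \<open>The permutation found below varies with \<epsilon>; summing over all pairs in
    \<open>?I\<close> gives a bound that does not mention it.\<close>
  have "negligible (\<lambda>\<epsilon>. a k \<epsilon> - b k \<epsilon>)"
  proof (rule negligible_dominated[OF _ g])
    fix \<epsilon> :: real assume e: "\<epsilon> \<in> {0<..1}"
    let ?d = "fact n * (\<Sum>ij\<in>?I. norm (g ij \<epsilon>))"
    obtain p where p: "p permutes {0..<n}" "\<And>i. i < n \<Longrightarrow> 1 \<le> fact n * cmod (W \<epsilon> $$ (i, p i))"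
      using unitary_large_transversal[OF mat_represents_carrier[OF W e] WW[OF e]] by blast
    have "\<bar>a i \<epsilon> - b (p i) \<epsilon>\<bar> \<le> ?d" if i: "i < n" for i
    proof -
      have pi: "p i < n" using permutes_in_image[OF p(1), of i] i by simp
      \<comment> \<open>The gap is multiplied by a factor that is at least 1 along the large
        transversal, which turns it into a multiple of an entry of \<open>g\<close>.\<close>
      have "\<bar>a i \<epsilon> - b (p i) \<epsilon>\<bar> * 1 \<le> \<bar>a i \<epsilon> - b (p i) \<epsilon>\<bar> * (fact n * cmod (W \<epsilon> $$ (i, p i)))"
        using p(2)[OF i] by (intro mult_left_mono) auto
      also have "\<dots> = fact n * norm (g (i, p i) \<epsilon>)"
        by (simp add: g_def norm_mult flip: of_real_diff)
      also have "\<dots> \<le> ?d"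
        using i pi by (intro mult_left_mono member_le_sum) auto
      finally show ?thesis by simp
    qed
    from sorted_dist_le_of_matching[where a = "\<lambda>i. a i \<epsilon>" and b = "\<lambda>i. b i \<epsilon>", OF a[OF e] b[OF e] p(1) this k]
    show "norm (a k \<epsilon> - b k \<epsilon>) \<le> ?d" by simp
  qed auto
  with represents_eq_iff[OF U(6) V(6)] k show ?thesis by blast
qed

section \<open>Eigenvalues with free eigenvectors\<close>

text \<open>The ring has zero divisors, so \<open>(x - l k) * y $ k = 0\<close> cannot be divided by
  a nonzero entry. Choosing the index of a largest entry separately at each \<epsilon>, and then
  using freeness of the whole vector, takes the place of this division.\<close>

lemma gen_eigenvalue_mat_diag_interleaving:
  assumes y: "y \<in> carrier_vec n" "gen_free y" "mat_diag n l *\<^sub>v y = x \<cdot>\<^sub>v y"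
  shows "interleaving n l x"
proof -
  have n: "n > 0"
  proof (rule ccontr)
    assume "\<not> n > 0"
    \<comment> \<open>In dimension 0 the scalar 1 annihilates every vector, so no vector is
      free.\<close>
    then have "1 \<cdot>\<^sub>v y = 0\<^sub>v (dim_vec y)" using y(1) by (intro eq_vecI) auto
    with y(2) have "(1 :: complex gen) = 0" unfolding gen_free_def by blast
    then show False by simp
  qed
  have ev: "(x - l k) * y $ k = 0" if "k < n" for k
  proof -
    have "(mat_diag n l *\<^sub>v y) $ k = (\<Sum>j<n. (if k = j then l j else 0) * y $ j)"
      using that y(1) by (simp add: mat_diag_def scalar_prod_def atLeast0LessThan)
    also have "\<dots> = (\<Sum>j<n. if k = j then l j * y $ j else 0)"
      by (rule sum.cong) auto
    also have "\<dots> = l k * y $ k" using that by simp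
    finally show ?thesis using y(1,3) that by (simp add: algebra_simps)
  qed
  define r where "r k = rep_gen (y $ k)" for k
  have "\<exists>k<n. \<forall>j<n. cmod (r j \<epsilon>) \<le> cmod (r k \<epsilon>)" for \<epsilon>
  proof -
    let ?N = "(\<lambda>j. cmod (r j \<epsilon>)) ` {..<n}"
    have "Max ?N \<in> ?N" using n by (intro Max_in) auto
    then obtain k where "k < n" "cmod (r k \<epsilon>) = Max ?N" by auto
    then show ?thesis by (intro exI[of _ k]) auto
  qed
  then obtain c where c: "\<And>\<epsilon>. c \<epsilon> < n" "\<And>\<epsilon> j. j < n \<Longrightarrow> cmod (r j \<epsilon>) \<le> cmod (r (c \<epsilon>) \<epsilon>)"
    by metis
  define S where "S k = {\<epsilon> \<in> {0<..1}. c \<epsilon> = k}" for k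
  define \<mu> where "\<mu> = x - (\<Sum>k<n. l k * gen_char (S k))"
  define s where "s \<epsilon> = rep_gen x \<epsilon> - (\<Sum>k<n. rep_gen (l k) \<epsilon> * (if \<epsilon> \<in> S k then 1 else 0))" for \<epsilon>
  have s: "represents s \<mu>"
    unfolding s_def \<mu>_def
    by (intro represents_diff represents_sum represents_mult represents_rep_gen represents_gen_char)
  \<comment> \<open>Exactly one cell contains a given \<epsilon> of the unit interval, so the sum
    collapses to the term with index \<open>c \<epsilon>\<close>.\<close>
  have se: "s \<epsilon> = rep_gen x \<epsilon> - rep_gen (l (c \<epsilon>)) \<epsilon>" if "\<epsilon> \<in> {0<..1}" for \<epsilon>
  proof -
    have "(\<Sum>k<n. rep_gen (l k) \<epsilon> * (if \<epsilon> \<in> S k then 1 else 0)) = (\<Sum>k<n. if k = c \<epsilon> then rep_gen (l k) \<epsilon> else 0)"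
      using that by (intro sum.cong) (auto simp: S_def)
    then show ?thesis using c(1)[of \<epsilon>] by (simp add: s_def)
  qed
  define g where "g k \<epsilon> = (rep_gen x \<epsilon> - rep_gen (l k) \<epsilon>) * r k \<epsilon>" for k \<epsilon>
  have "represents (g k) ((x - l k) * y $ k)" for k
    unfolding g_def r_def by (intro represents_mult represents_diff represents_rep_gen)
  then have g: "negligible (g k)" if "k < n" for k
    using ev[OF that] represents_eq_zero_iff by blast
  \<comment> \<open>Maximality of \<open>c \<epsilon>\<close> bounds every product by one negligible \<open>g k\<close>; no lower bound on \<open>y\<close> is needed.\<close>
  have "\<mu> * y $ j = 0" if j: "j < n" for j
  proof -
    have "negligible (\<lambda>\<epsilon>. s \<epsilon> * r j \<epsilon>)"
    proof (rule negligible_dominated[where C = 1 and I = "{..<n}" and g = g])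
      fix \<epsilon> :: real assume e: "\<epsilon> \<in> {0<..1}"
      have "norm (s \<epsilon> * r j \<epsilon>) \<le> norm (g (c \<epsilon>) \<epsilon>)"
        unfolding g_def se[OF e] norm_mult by (intro mult_left_mono c(2) j) auto
      also have "\<dots> \<le> 1 * (\<Sum>k<n. norm (g k \<epsilon>))"
        using c(1)[of \<epsilon>] by (simp, intro member_le_sum) auto
      finally show "norm (s \<epsilon> * r j \<epsilon>) \<le> 1 * (\<Sum>k<n. norm (g k \<epsilon>))" .
    qed (use g in auto)
    moreover have "represents (\<lambda>\<epsilon>. s \<epsilon> * r j \<epsilon>) (\<mu> * y $ j)"
      unfolding r_def by (intro represents_mult s represents_rep_gen)
    ultimately show ?thesis using represents_eq_zero_iff by blast
  qed
  then have "\<mu> \<cdot>\<^sub>v y = 0\<^sub>v (dim_vec y)" using y(1) by (intro eq_vecI) auto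
  then have "\<mu> = 0" using y(2) by (simp add: gen_free_def)
  then have "x = (\<Sum>k<n. l k * gen_char (S k))" by (simp add: \<mu>_def)
  moreover have "disjoint_family_on S {..<n}" by (auto simp: disjoint_family_on_def S_def)
  moreover have "(\<Union>k<n. S k) = {0<..1}" using c(1) by (auto simp: S_def)
  ultimately show ?thesis unfolding interleaving_def by blast
qed

lemma mult_mat_smult_vec:
  fixes M :: "'a :: comm_ring_1 mat"
  assumes "M \<in> carrier_mat m n" "v \<in> carrier_vec n"
  shows "M *\<^sub>v (c \<cdot>\<^sub>v v) = c \<cdot>\<^sub>v (M *\<^sub>v v)"
  using assms by (intro eq_vecI) (auto simp: scalar_prod_def sum_distrib_left ac_simps)

text \<open>Applying \<open>U\<close> recovers \<open>x\<close>, so a scalar annihilating the image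
  also annihilates \<open>x\<close>.\<close>

lemma gen_free_unitary:
  assumes "U \<in> carrier_mat n n" "gen_adjoint U * U = 1\<^sub>m n" "U * gen_adjoint U = 1\<^sub>m n"
    and x: "x \<in> carrier_vec n" "gen_free x"
  shows "gen_free (gen_adjoint U *\<^sub>v x)"
  unfolding gen_free_def
proof (intro allI impI)
  note aU = gen_adjoint_carrier[OF assms(1)]
  let ?y = "gen_adjoint U *\<^sub>v x"
  fix \<mu> assume *: "\<mu> \<cdot>\<^sub>v ?y = 0\<^sub>v (dim_vec ?y)"
  have y: "?y \<in> carrier_vec n" by (rule mult_mat_vec_carrier[OF aU x(1)])
  have "U *\<^sub>v ?y = x"
    using assoc_mult_mat_vec[OF assms(1) aU x(1)] x(1) by (simp add: assms(3))
  then have "\<mu> \<cdot>\<^sub>v x = U *\<^sub>v (\<mu> \<cdot>\<^sub>v ?y)"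
    using mult_mat_smult_vec[OF assms(1) y] by simp
  also have "\<dots> = 0\<^sub>v (dim_vec x)"
    unfolding * carrier_vecD[OF y] using assms(1) x(1) by (intro eq_vecI) auto
  finally show "\<mu> = 0" using x(2) by (simp add: gen_free_def)
qed

section \<open>Spectrum and diagonalization of a Hermitian generalized matrix\<close>

theorem proposition3p25:
  fixes n :: nat and A :: "complex gen mat"
    and Ae :: "real \<Rightarrow> complex mat"
    and le :: "nat \<Rightarrow> real \<Rightarrow> complex"
  assumes A: "A \<in> carrier_mat n n" "gen_hermitian A"
    and rep: "mat_represents n Ae A"
    and eig: "\<And>\<epsilon>. \<epsilon> \<in> {0<..1} \<Longrightarrow> ordered_eigenvalues n (Ae \<epsilon>) (\<lambda>k. le k \<epsilon>)"
  shows "\<exists>l :: nat \<Rightarrow> real gen.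
    (\<forall>k<n. represents (le k) (gen_of_real (l k))) \<and>
    (\<forall>i j. i \<le> j \<and> j < n \<longrightarrow> l j \<le>\<^sub>g l i) \<and>
    (\<forall>Be me. mat_represents n Be A \<and>
        (\<forall>\<epsilon>\<in>{0<..1}. ordered_eigenvalues n (Be \<epsilon>) (\<lambda>k. me k \<epsilon>)) \<longrightarrow>
        (\<forall>k<n. represents (me k) (gen_of_real (l k)))) \<and>
    (\<forall>x. gen_eigenvalue A x \<longrightarrow> interleaving n (\<lambda>k. gen_of_real (l k)) x) \<and>
    (\<exists>U \<in> carrier_mat n n. gen_unitary U \<and>
        gen_adjoint U * A * U = mat_diag n (\<lambda>k. gen_of_real (l k)))"
proof -
  \<comment> \<open>At a single \<epsilon> the eigenvalues may be non-real; their real parts supply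
    real representatives, and \<open>le\<close> below says that the imaginary parts are lost in the
    quotient.\<close>
  define l where "l k = abs_gen (\<lambda>\<epsilon>. Re (le k \<epsilon>))" for k
  obtain Y U where U: "U \<in> carrier_mat n n" "mat_represents n Y U"
    "\<And>\<epsilon>. \<epsilon> \<in> {0<..1} \<Longrightarrow> Y \<epsilon> * adj (Y \<epsilon>) = 1\<^sub>m n"
    "gen_adjoint U * U = 1\<^sub>m n" "U * gen_adjoint U = 1\<^sub>m n"
    "gen_adjoint U * A * U = mat_diag n (\<lambda>k. gen_of_real (l k))"
    and re: "\<And>k. k < n \<Longrightarrow> represents (\<lambda>\<epsilon>. Re (le k \<epsilon>)) (l k)"
    and le: "\<And>k. k < n \<Longrightarrow> represents (le k) (gen_of_real (l k))"
    unfolding l_def using gen_hermitian_diagonalization[OF A rep eig] by metis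
  have sorted: "Re (f j) \<le> Re (f i)"
    if "ordered_eigenvalues n M f" "i \<le> j" "j < n" for f :: "nat \<Rightarrow> complex" and M i j
    using that by (simp add: ordered_eigenvalues_def)
  have ord: "l j \<le>\<^sub>g l i" if ij: "i \<le> j" "j < n" for i j
  proof -
    \<comment> \<open>The real parts are already ordered at every \<epsilon>, so they are the
      representatives that \<open>gen_le\<close> asks for.\<close>
    have "\<forall>\<epsilon>\<in>{0<..1}. Re (le j \<epsilon>) \<le> Re (le i \<epsilon>)" by (intro ballI sorted[OF eig ij])
    moreover have "i < n" using ij by simp
    ultimately show ?thesis unfolding gen_le_def using re ij(2) by blast
  qed
  have indep: "represents (me k) (gen_of_real (l k))"
    if Be: "mat_represents n Be A" and me: "\<And>\<epsilon>. \<epsilon> \<in> {0<..1} \<Longrightarrow> ordered_eigenvalues n (Be \<epsilon>) (\<lambda>k. me k \<epsilon>)"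
      and k: "k < n" for Be me k
  proof -
    define m where "m k = abs_gen (\<lambda>\<epsilon>. Re (me k \<epsilon>))" for k
    obtain Z V where V: "V \<in> carrier_mat n n" "mat_represents n Z V"
      "\<And>\<epsilon>. \<epsilon> \<in> {0<..1} \<Longrightarrow> adj (Z \<epsilon>) * Z \<epsilon> = 1\<^sub>m n" "V * gen_adjoint V = 1\<^sub>m n"
      "gen_adjoint V * A * V = mat_diag n (\<lambda>k. gen_of_real (m k))"
      and rm: "\<And>k. k < n \<Longrightarrow> represents (\<lambda>\<epsilon>. Re (me k \<epsilon>)) (m k)"
      and me': "\<And>k. k < n \<Longrightarrow> represents (me k) (gen_of_real (m k))"
      unfolding m_def using gen_hermitian_diagonalization[OF A Be me] by metis
    \<comment> \<open>Each representative of \<open>A\<close> yields its own diagonalization of the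
      same generalized matrix, with its own sorted diagonal.\<close>
    have "l k = m k"
      by (rule sorted_spectrum_unique[OF A(1) U(1-3,5,6) re V rm sorted[OF eig] sorted[OF me] k])
    then show ?thesis using me'[OF k] by simp
  qed
  have inter: "interleaving n (\<lambda>k. gen_of_real (l k)) x" if ev: "gen_eigenvalue A x" for x
  proof -
    obtain v where v: "v \<in> carrier_vec n" "gen_free v" "A *\<^sub>v v = x \<cdot>\<^sub>v v"
      using ev A(1) by (auto simp: gen_eigenvalue_def)
    note aU = gen_adjoint_carrier[OF U(1)]
    let ?y = "gen_adjoint U *\<^sub>v v"
    have y: "?y \<in> carrier_vec n" by (rule mult_mat_vec_carrier[OF aU v(1)])
    have Uy: "U *\<^sub>v ?y = v"
      using assoc_mult_mat_vec[OF U(1) aU v(1)] v(1) by (simp add: U(5))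
    \<comment> \<open>In the coordinates given by \<open>U\<close> the eigenvector equation for
      \<open>A\<close> becomes one for the diagonal matrix, with the same \<open>x\<close>.\<close>
    have "mat_diag n (\<lambda>k. gen_of_real (l k)) *\<^sub>v ?y = gen_adjoint U * A *\<^sub>v (U *\<^sub>v ?y)"
      unfolding U(6)[symmetric] by (rule assoc_mult_mat_vec[OF mult_carrier_mat[OF aU A(1)] U(1) y])
    also have "\<dots> = x \<cdot>\<^sub>v ?y"
      unfolding Uy using assoc_mult_mat_vec[OF aU A(1) v(1)] mult_mat_smult_vec[OF aU v(1)] v(3) by simp
    finally show ?thesis
      by (rule gen_eigenvalue_mat_diag_interleaving[OF y gen_free_unitary[OF U(1,4,5) v(1,2)]])
  qed
  show ?thesis
  proof (intro exI[of _ l] conjI allI impI)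
    show "\<exists>U\<in>carrier_mat n n. gen_unitary U \<and>
        gen_adjoint U * A * U = mat_diag n (\<lambda>k. gen_of_real (l k))"
      using U(1,4,6) by (intro bexI[of _ U]) (simp_all add: gen_unitary_def)
  qed (use le ord indep inter in auto)
qed

end
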